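(* Given an initial curve $\vec X_0=\vec X(0)$ with $n$ points in $\mathbb R^p$ with corresponding interior $\vec U_0=\vec U(0)$, and end-point boundary conditions $X_1(t)=f_1(t)$ and $X_n(t)=f_n(t)$, the semi-discrete hyperbolic curvature flow $$\ddot{\vec U}+\beta\dot{\vec U}=A\vec U+f_1(t)e_1+f_n(t)e_n$$ has a unique solution given by $$\begin{bmatrix}\vec U(t)\\ \vec V(t)\end{bmatrix}=P\,\mathrm{diag}(e^{\lambda_1t},e^{\lambda_2t},\dots,e^{\lambda_{2n-4}t})P^{-1}\begin{bmatrix}\vec U_0\\ \vec V_0\end{bmatrix}+P\int_0^t\mathrm{diag}\big(e^{\lambda_1(t-s)},e^{\lambda_2(t-s)},\dots,e^{\lambda_{2n-4}(t-s)}\big)P^{-1}\vec F(s)\,ds .$$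
   Context: Fix integers $n\ge4$, $p\ge2$ and a damping parameter $\beta\ge0$. A piecewise linear curve is $\vec X=(X_1,\dots,X_n)^\top$ with $X_i\in\mathbb R^p$, viewed as an $n\times p$ matrix; its interior is the $(n-2)\times p$ matrix $\vec U=(X_2,\dots,X_{n-1})^\top$. $\vec V=\dot{\vec U}$ is the velocity of the interior points and $\vec V_0=\vec V(0)$ is its initial value. $A=\mathrm{tridiag}(1,-2,1)$ is the $(n-2)\times(n-2)$ tridiagonal matrix with diagonal entries $-2$ and sub-/superdiagonal entries $1$. $f_1(t)e_1+f_n(t)e_n$ is the $(n-2)\times p$ matrix with first row $f_1(t)$, last row $f_n(t)$ and other rows zero. $\vec F(t)=\begin{bmatrix}0\\ f_1(t)e_1+f_n(t)e_n\end{bmatrix}$ is a $(2n-4)\times p$ matrix. $\lambda_1,\dots,\lambda_{2n-4}$ are the eigenvalues of $M=\begin{bmatrix}0&I\\ A&-\beta I\end{bmatrix}$, namely $\frac{-\beta\pm\sqrt{\beta^2+4\mu_k}}2$ with $\mu_k=-2+2\cos\frac{k\pi}{n-1}$, $k=1,\dots,n-2$, and $P$ is the eigenvector matrix of $M$: its $j$-th column is the eigenvector $(u_k,\lambda_ju_k)^\top$ for $\lambda_j$, with $(u_k)_i=\sin\frac{ik\pi}{n-1}$.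
   Formalization: The formula is claimed only when β²+4μ_k≠0 for all k=1,…,n−2 (otherwise P is singular and P⁻¹ does not exist); existence and uniqueness are claimed for every β≥0. f_1 and f_n are assumed continuous on t≥0, and X_0 agrees with them at t=0. *)

theory Defs
  imports
    "HOL-Analysis.Henstock_Kurzweil_Integration"
    "Jordan_Normal_Form.Char_Poly"
begin

unbundle no vec_syntax

text \<open>
  A curve with \<open>n\<close> points in \<open>\<real>\<^sup>p\<close> is a matrix in \<open>carrier_mat n p\<close> whose rows are the points.
  Matrix indices start at 0, so the points \<open>X\<^sub>1, \<dots>, X\<^sub>n\<close> are the rows \<open>0, \<dots>, n - 1\<close>.
\<close>

definition interior_mat :: "'a mat \<Rightarrow> 'a mat" where
  "interior_mat X = mat (dim_row X - 2) (dim_col X) (\<lambda>(i, j). X $$ (i + 1, j))"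

definition tridiag_mat :: "nat \<Rightarrow> 'a \<Rightarrow> 'a \<Rightarrow> 'a \<Rightarrow> 'a :: zero mat" where
  "tridiag_mat m a b c =
     mat m m (\<lambda>(i, j). if i = j + 1 then a else if i = j then b else if j = i + 1 then c else 0)"

definition row_mat :: "nat \<Rightarrow> nat \<Rightarrow> 'a vec \<Rightarrow> 'a :: zero mat" where
  "row_mat m k v = mat m (dim_vec v) (\<lambda>(i, j). if i = k then v $ j else 0)"

definition boundary_mat :: "nat \<Rightarrow> 'a vec \<Rightarrow> 'a vec \<Rightarrow> 'a :: monoid_add mat" where
  "boundary_mat m a b = row_mat m 0 a + row_mat m (m - 1) b"

text \<open>
  The matrix type carries no topology (its dimensions are not part of the type), so derivatives
  and integrals of matrix-valued functions of a real variable are taken entrywise.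
\<close>

definition has_mat_derivative :: "(real \<Rightarrow> real mat) \<Rightarrow> real mat \<Rightarrow> real filter \<Rightarrow> bool" where
  "has_mat_derivative G D F \<longleftrightarrow>
     (\<forall>i < dim_row D. \<forall>j < dim_col D.
        ((\<lambda>t. G t $$ (i, j)) has_real_derivative D $$ (i, j)) F)"

definition mat_integral :: "real \<Rightarrow> real \<Rightarrow> (real \<Rightarrow> complex mat) \<Rightarrow> complex mat" where
  "mat_integral a b G =
     mat (dim_row (G a)) (dim_col (G a)) (\<lambda>(i, j). integral {a..b} (\<lambda>s. G s $$ (i, j)))"

text \<open>
  \<open>X\<close> is the evolving curve and \<open>V\<close> the velocity of its interior; \<open>W\<close> is the acceleration.
  At \<open>t = 0\<close> the derivatives are one-sided.
\<close>

definition hyperbolic_flow_solution ::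
  "nat \<Rightarrow> nat \<Rightarrow> real \<Rightarrow> (real \<Rightarrow> real vec) \<Rightarrow> (real \<Rightarrow> real vec) \<Rightarrow> real mat \<Rightarrow> real mat
    \<Rightarrow> (real \<Rightarrow> real mat) \<Rightarrow> (real \<Rightarrow> real mat) \<Rightarrow> bool" where
  "hyperbolic_flow_solution n p \<beta> f\<^sub>1 f\<^sub>n X\<^sub>0 V\<^sub>0 X V \<longleftrightarrow>
     (\<forall>t\<ge>0. X t \<in> carrier_mat n p \<and> V t \<in> carrier_mat (n - 2) p) \<and>
     X 0 = X\<^sub>0 \<and> V 0 = V\<^sub>0 \<and>
     (\<forall>t\<ge>0. row (X t) 0 = f\<^sub>1 t \<and> row (X t) (n - 1) = f\<^sub>n t) \<and>
     (\<forall>t\<ge>0. has_mat_derivative (\<lambda>s. interior_mat (X s)) (V t) (at t within {0..})) \<and>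
     (\<forall>t\<ge>0. \<exists>W \<in> carrier_mat (n - 2) p.
        has_mat_derivative V W (at t within {0..}) \<and>
        W + \<beta> \<cdot>\<^sub>m V t =
          tridiag_mat (n - 2) 1 (-2) 1 * interior_mat (X t) + boundary_mat (n - 2) (f\<^sub>1 t) (f\<^sub>n t))"

definition system_mat :: "nat \<Rightarrow> real \<Rightarrow> complex mat" where
  "system_mat n \<beta> =
     four_block_mat
       (0\<^sub>m (n - 2) (n - 2)) (1\<^sub>m (n - 2))
       (tridiag_mat (n - 2) 1 (-2) 1) (- of_real \<beta> \<cdot>\<^sub>m 1\<^sub>m (n - 2))"

definition mu :: "nat \<Rightarrow> nat \<Rightarrow> real" where
  "mu n k = - 2 + 2 * cos (real k * pi / real (n - 1))"

text \<open>
  The \<open>2n - 4\<close> eigenvalues are numbered \<open>j = 0, \<dots>, 2n - 5\<close>: first the branch with sign \<open>+\<close> for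
  \<open>k = 1, \<dots>, n - 2\<close>, then the branch with sign \<open>-\<close>. The sign convention of \<open>csqrt\<close> is
  immaterial because both signs occur.
\<close>

definition mode :: "nat \<Rightarrow> nat \<Rightarrow> nat" where
  "mode n j = (if j < n - 2 then j + 1 else j - (n - 2) + 1)"

definition lam :: "nat \<Rightarrow> real \<Rightarrow> nat \<Rightarrow> complex" where
  "lam n \<beta> j =
     (let r = csqrt (of_real (\<beta>\<^sup>2 + 4 * mu n (mode n j)))
      in if j < n - 2 then (- of_real \<beta> + r) / 2 else (- of_real \<beta> - r) / 2)"

definition sine_vec :: "nat \<Rightarrow> nat \<Rightarrow> complex vec" where
  "sine_vec n k = vec (n - 2) (\<lambda>i. of_real (sin (real (i + 1) * real k * pi / real (n - 1))))"

definition eigenvector_mat :: "nat \<Rightarrow> real \<Rightarrow> complex mat" where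
  "eigenvector_mat n \<beta> =
     mat_of_cols (2 * n - 4)
       (map (\<lambda>j. sine_vec n (mode n j) @\<^sub>v (lam n \<beta> j \<cdot>\<^sub>v sine_vec n (mode n j))) [0..<2 * n - 4])"

definition forcing_mat ::
  "nat \<Rightarrow> nat \<Rightarrow> (real \<Rightarrow> real vec) \<Rightarrow> (real \<Rightarrow> real vec) \<Rightarrow> real \<Rightarrow> real mat" where
  "forcing_mat n p f\<^sub>1 f\<^sub>n t = 0\<^sub>m (n - 2) p @\<^sub>r boundary_mat (n - 2) (f\<^sub>1 t) (f\<^sub>n t)"

definition exp_diag :: "nat \<Rightarrow> real \<Rightarrow> real \<Rightarrow> complex mat" where
  "exp_diag n \<beta> t = mat_diag (2 * n - 4) (\<lambda>j. exp (lam n \<beta> j * of_real t))"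

abbreviation cmat :: "real mat \<Rightarrow> complex mat" where
  "cmat \<equiv> map_mat complex_of_real"

lemma dim_sine_vec: "dim_vec (sine_vec n k) = n - 2" by (simp add: sine_vec_def)

lemma tridiag_mult_sine_vec:
  assumes n: "n \<ge> 3"
  shows "tridiag_mat (n - 2) 1 (-2) 1 *\<^sub>v sine_vec n k = of_real (mu n k) \<cdot>\<^sub>v sine_vec n k"
proof (rule eq_vecI)
  fix i
  assume "i < dim_vec (of_real (mu n k) \<cdot>\<^sub>v sine_vec n k)"
  then have i: "i < n - 2" by (simp add: sine_vec_def)
  define \<theta> where "\<theta> = real k * pi / real (n - 1)"
  define s where "s j = complex_of_real (sin (real j * \<theta>))" for j :: nat
  have u: "sine_vec n k $ j = s (j + 1)" if "j < n - 2" for j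
    using that by (simp only: sine_vec_def s_def \<theta>_def index_vec times_divide_eq_right mult.assoc)
  have "sin (real (n - 1) * \<theta>) = sin (real k * pi)"
    using n by (simp add: \<theta>_def)
  then have send: "s (n - 1) = 0" by (simp add: s_def)
  have s0: "s 0 = 0" by (simp add: s_def)
  have "(tridiag_mat (n - 2) 1 (-2) 1 *\<^sub>v sine_vec n k) $ i =
      (\<Sum>j<n - 2. (if i = j + 1 then 1 else if i = j then - 2 else if j = i + 1 then 1 else 0) * s (j + 1))"
    using i by (auto simp: tridiag_mat_def scalar_prod_def lessThan_atLeast0 u dim_sine_vec
        intro!: sum.cong)
  also have "\<dots> = (\<Sum>j<n - 2. if i = j + 1 then s (j + 1) else 0) +
       (\<Sum>j<n - 2. if i = j then - 2 * s (j + 1) else 0) +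
       (\<Sum>j<n - 2. if j = i + 1 then s (j + 1) else 0)"
    unfolding sum.distrib[symmetric] by (rule sum.cong) auto
  also have "(\<Sum>j<n - 2. if i = j then - 2 * s (j + 1) else 0) = - 2 * s (i + 1)"
    using i by (subst sum.delta') auto
  also have "(\<Sum>j<n - 2. if j = i + 1 then s (j + 1) else 0) = s (i + 2)"
  proof (cases "i + 1 < n - 2")
    case False
    with i have "i + 2 = n - 1" by linarith
    then show ?thesis using send False by simp
  qed (subst sum.delta, auto)
  also have "(\<Sum>j<n - 2. if i = j + 1 then s (j + 1) else 0) = s i"
  proof (cases i)
    case (Suc i')
    then have "(\<Sum>j<n - 2. if i = j + 1 then s (j + 1) else 0) =
        (\<Sum>j<n - 2. if i' = j then s (j + 1) else 0)"
      by (intro sum.cong) auto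
    then show ?thesis using i Suc by simp
  qed (simp add: s0)
  also have "s i + - 2 * s (i + 1) + s (i + 2) = of_real (mu n k) * s (i + 1)"
  proof -
    have e: "real i * \<theta> = real (i + 1) * \<theta> - \<theta>" "real (i + 2) * \<theta> = real (i + 1) * \<theta> + \<theta>"
      by (simp_all add: algebra_simps)
    have m: "mu n k = - 2 + 2 * cos \<theta>"
      by (simp add: mu_def \<theta>_def)
    have "sin (real i * \<theta>) + - 2 * sin (real (i + 1) * \<theta>) + sin (real (i + 2) * \<theta>) =
        mu n k * sin (real (i + 1) * \<theta>)"
      unfolding e sin_add sin_diff m by (simp only: ring_distribs) simp
    from arg_cong[OF this, of complex_of_real] show ?thesis
      unfolding s_def by (simp only: of_real_mult of_real_add of_real_minus of_real_numeral)
  qed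
  finally show "(tridiag_mat (n - 2) 1 (-2) 1 *\<^sub>v sine_vec n k) $ i =
      (of_real (mu n k) \<cdot>\<^sub>v sine_vec n k) $ i"
    using i by (simp add: u dim_sine_vec)
qed (simp add: tridiag_mat_def sine_vec_def)

lemma lam_quadratic:
  "(lam n \<beta> j)\<^sup>2 = of_real (mu n (mode n j)) - of_real \<beta> * lam n \<beta> j"
proof -
  define r where "r = csqrt (of_real (\<beta>\<^sup>2 + 4 * mu n (mode n j)))"
  have r: "r\<^sup>2 = of_real (\<beta>\<^sup>2 + 4 * mu n (mode n j))" by (simp add: r_def)
  have "lam n \<beta> j = (- of_real \<beta> + r) / 2 \<or> lam n \<beta> j = (- of_real \<beta> - r) / 2"
    by (simp add: lam_def r_def Let_def)
  then show ?thesis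
  proof
    assume l: "lam n \<beta> j = (- of_real \<beta> + r) / 2"
    have "r = 2 * lam n \<beta> j + of_real \<beta>" unfolding l by (simp add: field_simps)
    with r have "4 * (lam n \<beta> j)\<^sup>2 = 4 * (of_real (mu n (mode n j)) - of_real \<beta> * lam n \<beta> j)"
      by (simp add: power2_eq_square algebra_simps)
    then show ?thesis by (subst (asm) mult_cancel_left) simp
  next
    assume l: "lam n \<beta> j = (- of_real \<beta> - r) / 2"
    have "r = - 2 * lam n \<beta> j - of_real \<beta>" unfolding l by (simp add: field_simps)
    with r have "4 * (lam n \<beta> j)\<^sup>2 = 4 * (of_real (mu n (mode n j)) - of_real \<beta> * lam n \<beta> j)"
      by (simp add: power2_eq_square algebra_simps)
    then show ?thesis by (subst (asm) mult_cancel_left) simp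
  qed
qed

lemma col_eigenvector_mat:
  assumes j: "j < 2 * n - 4"
  shows "col (eigenvector_mat n \<beta>) j =
     sine_vec n (mode n j) @\<^sub>v (lam n \<beta> j \<cdot>\<^sub>v sine_vec n (mode n j))"
proof -
  define w where "w j = sine_vec n (mode n j) @\<^sub>v (lam n \<beta> j \<cdot>\<^sub>v sine_vec n (mode n j))" for j
  have "dim_vec (w j) = 2 * n - 4"
    unfolding w_def index_append_vec(2) index_smult_vec(2) dim_sine_vec by linarith
  then have "w j \<in> carrier_vec (2 * n - 4)" by (rule carrier_vecI)
  then have "col (mat_of_cols (2 * n - 4) (map w [0..<2 * n - 4])) j = w j"
    using j by (subst col_mat_of_cols) simp_all
  then show ?thesis unfolding eigenvector_mat_def w_def .
qed

lemma sine_vec_nonzero: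
  assumes "1 \<le> k" "k \<le> n - 2" 
  shows "sine_vec n k $ 0 \<noteq> 0"
proof -
  have "pi * real k < pi * real (n - 1)" using assms by (intro mult_strict_left_mono) auto
  then have "real k * pi / real (n - 1) < pi" "real k * pi / real (n - 1) > 0"
    using assms by (auto simp: pos_divide_less_eq mult.commute)
  then have pos: "sin (real k * pi / real (n - 1)) > 0"
    by (intro sin_gt_zero) auto
  have "0 < n - 2" using assms by linarith
  then have "sine_vec n k $ 0 = of_real (sin (real k * pi / real (n - 1)))"
    unfolding sine_vec_def by (subst index_vec) simp_all
  with pos show ?thesis by (simp only: of_real_eq_0_iff)
qed

lemma eigenvector_system_mat:
  assumes n: "n \<ge> 3" and j: "j < 2 * n - 4"
  shows "eigenvector (system_mat n \<beta>) (col (eigenvector_mat n \<beta>) j) (lam n \<beta> j)"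
proof -
  define u where "u = sine_vec n (mode n j)"
  define l where "l = lam n \<beta> j"
  have u: "u \<in> carrier_vec (n - 2)" by (simp add: u_def sine_vec_def)
  have k: "1 \<le> mode n j" "mode n j \<le> n - 2"
    using j by (auto simp: mode_def)
  have u0: "u $ 0 \<noteq> 0" unfolding u_def using k by (rule sine_vec_nonzero)
  have M: "system_mat n \<beta> \<in> carrier_mat (2 * n - 4) (2 * n - 4)"
  proof -
    have "tridiag_mat (n - 2) 1 (-2) 1 \<in> carrier_mat (n - 2) (n - 2)"
      by (simp add: tridiag_mat_def)
    then have "system_mat n \<beta> \<in> carrier_mat (n - 2 + (n - 2)) (n - 2 + (n - 2))"
      unfolding system_mat_def by (intro four_block_carrier_mat) auto
    moreover have "n - 2 + (n - 2) = 2 * n - 4" by simp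
    ultimately show ?thesis by (simp only:)
  qed
  have c: "col (eigenvector_mat n \<beta>) j = u @\<^sub>v (l \<cdot>\<^sub>v u)"
    using col_eigenvector_mat[OF j] by (simp add: u_def l_def)
  have "system_mat n \<beta> *\<^sub>v (u @\<^sub>v (l \<cdot>\<^sub>v u)) =
     (0\<^sub>m (n - 2) (n - 2) *\<^sub>v u + 1\<^sub>m (n - 2) *\<^sub>v (l \<cdot>\<^sub>v u)) @\<^sub>v
     (tridiag_mat (n - 2) 1 (-2) 1 *\<^sub>v u + (- of_real \<beta> \<cdot>\<^sub>m 1\<^sub>m (n - 2)) *\<^sub>v (l \<cdot>\<^sub>v u))"
    unfolding system_mat_def
    by (rule four_block_mat_mult_vec) (use u in \<open>auto simp: tridiag_mat_def\<close>)
  also have "1\<^sub>m (n - 2) *\<^sub>v (l \<cdot>\<^sub>v u) = l \<cdot>\<^sub>v u" using u by auto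
  also have "0\<^sub>m (n - 2) (n - 2) *\<^sub>v u + l \<cdot>\<^sub>v u = l \<cdot>\<^sub>v u" using u by auto
  also have "(- of_real \<beta> \<cdot>\<^sub>m 1\<^sub>m (n - 2)) *\<^sub>v (l \<cdot>\<^sub>v u) = (- of_real \<beta> * l) \<cdot>\<^sub>v u"
    using u by (intro eq_vecI) (simp_all add: smult_scalar_prod_distrib[of _ "n - 2"])
  also have "tridiag_mat (n - 2) 1 (-2) 1 *\<^sub>v u = of_real (mu n (mode n j)) \<cdot>\<^sub>v u"
    unfolding u_def by (rule tridiag_mult_sine_vec[OF n])
  also have "of_real (mu n (mode n j)) \<cdot>\<^sub>v u + (- of_real \<beta> * l) \<cdot>\<^sub>v u = l\<^sup>2 \<cdot>\<^sub>v u"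
    unfolding add_smult_distrib_vec[symmetric] by (simp add: l_def lam_quadratic)
  also have "(l \<cdot>\<^sub>v u) @\<^sub>v (l\<^sup>2 \<cdot>\<^sub>v u) = l \<cdot>\<^sub>v (u @\<^sub>v (l \<cdot>\<^sub>v u))"
    using u by (intro eq_vecI) (auto simp: power2_eq_square)
  finally have eq: "system_mat n \<beta> *\<^sub>v (u @\<^sub>v (l \<cdot>\<^sub>v u)) = l \<cdot>\<^sub>v (u @\<^sub>v (l \<cdot>\<^sub>v u))" .
  have "(u @\<^sub>v (l \<cdot>\<^sub>v u)) $ 0 \<noteq> 0\<^sub>v (2 * n - 4) $ 0" using u u0 n by auto
  then have nz: "u @\<^sub>v (l \<cdot>\<^sub>v u) \<noteq> 0\<^sub>v (2 * n - 4)" by metis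
  have cv: "u @\<^sub>v (l \<cdot>\<^sub>v u) \<in> carrier_vec (2 * n - 4)" using append_carrier_vec[OF u, of "l \<cdot>\<^sub>v u" "n - 2"] u
    by (simp add: mult_2[symmetric] diff_mult_distrib2)
  show ?thesis unfolding eigenvector_def c l_def[symmetric] using eq nz cv M by auto
qed

text \<open>
  If the discriminant vanishes for some \<open>k\<close>, the two columns belonging to \<open>k\<close> coincide and the
  eigenvector matrix has no inverse.
\<close>

lemma eigenvector_mat_singular:
  assumes k: "k \<in> {1..n - 2}" and "\<beta>\<^sup>2 + 4 * mu n k = 0"
  shows "\<not> invertible_mat (eigenvector_mat n \<beta>)"
proof
  let ?P = "eigenvector_mat n \<beta>"
  have P: "?P \<in> carrier_mat (2 * n - 4) (2 * n - 4)"
    unfolding eigenvector_mat_def by (intro carrier_matI) simp_all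
  have "1 \<le> k" "k \<le> n - 2" using k by simp_all
  then obtain m where m: "k = m + 1" "m < n - 2"
    by (metis Suc_eq_plus1 Suc_le_eq le_add_diff_inverse2 One_nat_def)
  have idx: "m < 2 * n - 4" "m + (n - 2) < 2 * n - 4" "m \<noteq> m + (n - 2)"
    using m(2) by linarith+
  have "\<not> m + (n - 2) < n - 2" by linarith
  then have md: "mode n m = k" "mode n (m + (n - 2)) = k"
    unfolding mode_def m(1) using m(2) by (simp_all only: if_True if_False add_diff_cancel_right')
  have "lam n \<beta> m = lam n \<beta> (m + (n - 2))"
    unfolding lam_def md assms(2) Let_def
    by (simp only: of_real_0 csqrt_0 add_0_right diff_0_right if_cancel)
  then have "col ?P m = col ?P (m + (n - 2))"
    unfolding col_eigenvector_mat[OF idx(1)] col_eigenvector_mat[OF idx(2)] md by (simp only:)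
  then have det: "det ?P = 0"
    by (rule det_identical_columns[OF P idx(3,1,2)])
  assume "invertible_mat ?P"
  then obtain Q where Q: "?P * Q = 1\<^sub>m (dim_row ?P)" "Q * ?P = 1\<^sub>m (dim_row Q)"
    unfolding invertible_mat_def inverts_mat_def by blast
  have "dim_col Q = dim_row ?P" "dim_col ?P = dim_row Q"
    using arg_cong[OF Q(1), of dim_col] arg_cong[OF Q(2), of dim_col]
    by (simp_all only: index_mult_mat index_one_mat)
  then have Qc: "Q \<in> carrier_mat (2 * n - 4) (2 * n - 4)"
    unfolding carrier_matD[OF P] by (intro carrier_matI) (simp_all only:)
  have "det ?P * det Q = 1"
    using det_mult[OF P Qc] unfolding Q(1) by (simp only: det_one)
  with det show False by (simp only: mult_zero_left zero_neq_one)
qed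

end

theory Submission
  imports Defs "Jordan_Normal_Form.Schur_Decomposition"
begin

text \<open>
  With \<open>Y = (U, V)\<close>, interior points stacked on velocities, the flow is the first-order linear system
  \<open>Y' = M Y + F\<close> with constant coefficients. What has to be shown splits into facts about such
  systems and facts about the particular matrix \<open>M\<close>.

  Existence and uniqueness must also cover the critically damped case, in which \<open>M\<close> is not
  diagonalisable. Over the complex numbers \<open>M\<close> is similar to an upper triangular matrix
  (\<open>similar_upper_triangular\<close>), and a linear change of unknowns carries solutions to solutions
  (\<open>linear_system_solution_change_variables\<close>). In a triangular system the last row is a scalar
  equation \<open>z' = l z + g\<close>, and every other row is one whose inhomogeneity involves only rows further
  down, so back substitution reduces everything to the scalar equation, which variation of constants
  solves explicitly and uniquely (\<open>scalar_linear_ode_formula\<close>, \<open>scalar_linear_ode_exists\<close>). Since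
  \<open>M\<close>, \<open>F\<close> and the initial data are real, the real part of the complex solution is a solution as
  well, and it provides the flow; the rows of the curve that are not interior are the prescribed
  boundary values.

  If no discriminant \<open>\<beta>\<^sup>2 + 4 \<mu>\<^sub>k\<close> vanishes, the \<open>2n - 4\<close> eigenvalues are pairwise distinct: an
  eigenvalue determines \<open>\<mu>\<^sub>k\<close> by its quadratic equation, \<open>\<mu>\<^sub>k\<close> determines \<open>k\<close> because the cosine is
  injective on \<open>[0, \<pi>]\<close>, and the two roots for one \<open>k\<close> differ (\<open>inj_on_lam\<close>). Eigenvectors for
  distinct eigenvalues are independent, so \<open>P\<close> has an inverse \<open>Q\<close> (\<open>eigenvector_cols_inverse\<close>). The
  unknowns \<open>Q Y\<close> satisfy a diagonal system; applying the scalar formula in every entry and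
  multiplying by \<open>P\<close> gives the stated representation.
\<close>

section \<open>The scalar equation\<close>

lemma has_vector_derivative_exp_mult:
  "((\<lambda>t. exp (c * complex_of_real t)) has_vector_derivative c * exp (c * of_real t)) (at t within S)"
  using exp_scaleR_has_vector_derivative_right[of c t S]
  by (simp add: scaleR_conv_of_real mult.commute)

text \<open>
  Variation of constants: \<open>s \<mapsto> exp (l (t - s)) z(s)\<close> has derivative \<open>exp (l (t - s)) g(s)\<close>, and the
  formula is the fundamental theorem of calculus for this function on \<open>[0, t]\<close>. In particular the
  initial value determines the solution.
\<close>

lemma scalar_linear_ode_formula:
  fixes z g :: "real \<Rightarrow> complex"
  assumes ode: "\<And>s. s \<ge> 0 \<Longrightarrow> (z has_vector_derivative l * z s + g s) (at s within {0..})"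
    and t: "t \<ge> 0"
  shows "z t = exp (l * of_real t) * z 0 + integral {0..t} (\<lambda>s. exp (l * of_real (t - s)) * g s)"
proof -
  have "((\<lambda>s. exp (l * of_real (t - s)) * g s) has_integral
      exp (l * of_real (t - t)) * z t - exp (l * of_real (t - 0)) * z 0) {0..t}"
  proof (rule fundamental_theorem_of_calculus[OF t])
    fix s assume s: "s \<in> {0..t}"
    have 1: "(z has_vector_derivative l * z s + g s) (at s within {0..t})"
      using ode[of s] s by (auto intro: has_vector_derivative_within_subset)
    have "((\<lambda>s. exp (- l * of_real s)) has_vector_derivative - l * exp (- l * of_real s))
        (at s within {0..t})"
      by (rule has_vector_derivative_exp_mult)
    from has_vector_derivative_mult_right[OF this, of "exp (l * of_real t)"]
    have 2: "((\<lambda>s. exp (l * of_real (t - s))) has_vector_derivative - l * exp (l * of_real (t - s)))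
        (at s within {0..t})"
      by (simp add: exp_add[symmetric] exp_minus exp_diff field_simps algebra_simps)
    show "((\<lambda>s. exp (l * of_real (t - s)) * z s) has_vector_derivative
        exp (l * of_real (t - s)) * g s) (at s within {0..t})"
      using has_vector_derivative_mult[OF 2 1] by (simp add: algebra_simps)
  qed
  then show ?thesis by (simp add: has_integral_iff)
qed

lemma scalar_linear_ode_exists:
  fixes g :: "real \<Rightarrow> complex"
  assumes g: "continuous_on {0..} g"
  shows "\<exists>z. z 0 = z0 \<and>
    (\<forall>t\<ge>0. (z has_vector_derivative l * z t + g t) (at t within {0..}))"
proof -
  define h where "h s = exp (- l * of_real s) * g s" for s
  define z where "z t = exp (l * of_real t) * (z0 + integral {0..t} h)" for t
  have h: "continuous_on {0..} h"
    unfolding h_def by (intro continuous_intros g)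
  have "(z has_vector_derivative l * z t + g t) (at t within {0..})" if t: "t \<ge> 0" for t
  proof -
    have "((\<lambda>u. integral {0..u} h) has_vector_derivative h t) (at t within {0..t + 1})"
      using t by (intro integral_has_vector_derivative continuous_on_subset[OF h]) auto
    \<comment> \<open>the interval ends beyond \<open>t\<close>, so that its right end point does not cut off the limit at \<open>t\<close>\<close>
    also have "at t within {0..t + 1} = at t within {0..}"
      by (rule at_within_nhd[of t "{..<t + 1}"]) auto
    finally have I: "((\<lambda>u. z0 + integral {0..u} h) has_vector_derivative h t) (at t within {0..})"
      using has_vector_derivative_add[OF has_vector_derivative_const] by fastforce
    have "exp (l * of_real t) * h t = g t"
      by (simp add: h_def exp_minus)
    with has_vector_derivative_mult[OF has_vector_derivative_exp_mult[of l t] I] show ?thesis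
      by (simp add: z_def[abs_def] algebra_simps)
  qed
  moreover have "z 0 = z0" by (simp add: z_def)
  ultimately show ?thesis by blast
qed

section \<open>Linear systems with constant coefficients\<close>

text \<open>
  The unknown is an \<open>N \<times> p\<close> matrix, that is, \<open>p\<close> vector-valued systems with the same coefficients:
  one for each coordinate of the ambient space \<open>\<real>\<^sup>p\<close>.
\<close>

definition linear_system_solution ::
  "nat \<Rightarrow> nat \<Rightarrow> complex mat \<Rightarrow> (real \<Rightarrow> complex mat) \<Rightarrow> (real \<Rightarrow> complex mat) \<Rightarrow> bool" where
  "linear_system_solution N p M F Y \<longleftrightarrow>
     (\<forall>t\<ge>0. Y t \<in> carrier_mat N p \<and>
        (\<forall>i<N. \<forall>j<p. ((\<lambda>s. Y s $$ (i, j)) has_vector_derivative (M * Y t + F t) $$ (i, j))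
           (at t within {0..})))"

lemma linear_system_solution_carrier:
  "linear_system_solution N p M F Y \<Longrightarrow> t \<ge> 0 \<Longrightarrow> Y t \<in> carrier_mat N p"
  by (simp add: linear_system_solution_def)

lemma index_mult_mat_sum:
  assumes "A \<in> carrier_mat l m" "B \<in> carrier_mat m r" "i < l" "j < r"
  shows "(A * B) $$ (i, j) = (\<Sum>k<m. A $$ (i, k) * B $$ (k, j))"
  using assms by (auto simp: scalar_prod_def lessThan_atLeast0 intro!: sum.cong)

text \<open>
  \<open>(B Y)' = B (M Y + F) = T (B Y) + B F\<close> whenever \<open>B\<close> intertwines \<open>M\<close> and \<open>T\<close>. Triangularisation in
  both directions and diagonalisation by eigenvectors are all instances.
\<close>

lemma linear_system_solution_change_variables:
  assumes Y: "linear_system_solution N p M F Y"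
    and M: "M \<in> carrier_mat N N" and T: "T \<in> carrier_mat N N" and B: "B \<in> carrier_mat N N"
    and F: "\<And>t. t \<ge> 0 \<Longrightarrow> F t \<in> carrier_mat N p"
    and BM: "B * M = T * B"
  shows "linear_system_solution N p T (\<lambda>t. B * F t) (\<lambda>t. B * Y t)"
  unfolding linear_system_solution_def
proof (intro allI impI conjI)
  fix t :: real assume t: "t \<ge> 0"
  have Yc: "Y s \<in> carrier_mat N p" if "s \<ge> 0" for s
    using Y that by (simp add: linear_system_solution_def)
  show "B * Y t \<in> carrier_mat N p" using B Yc[OF t] by simp
  fix i j assume i: "i < N" and j: "j < p"
  have "((\<lambda>s. \<Sum>k<N. B $$ (i, k) * Y s $$ (k, j)) has_vector_derivative
      (\<Sum>k<N. B $$ (i, k) * (M * Y t + F t) $$ (k, j))) (at t within {0..})"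
    using Y t j by (intro derivative_intros) (simp add: linear_system_solution_def)
  also have "(\<Sum>k<N. B $$ (i, k) * (M * Y t + F t) $$ (k, j)) = (B * (M * Y t + F t)) $$ (i, j)"
    using M Yc[OF t] F[OF t] B i j by (intro index_mult_mat_sum[symmetric]) auto
  also have "B * (M * Y t + F t) = B * M * Y t + B * F t"
    using M Yc[OF t] F[OF t] B
    by (simp add: mult_add_distrib_mat[of _ N N _ p] assoc_mult_mat[of _ N N _ N _ p])
  also have "\<dots> = T * (B * Y t) + B * F t"
    unfolding BM using T Yc[OF t] B by (simp add: assoc_mult_mat[of _ N N _ N _ p])
  finally show "((\<lambda>s. (B * Y s) $$ (i, j)) has_vector_derivative
      (T * (B * Y t) + B * F t) $$ (i, j)) (at t within {0..})"
  proof (rule has_vector_derivative_transform[rotated 2])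
    show "t \<in> {0..}" using t by simp
    fix s :: real assume "s \<in> {0..}"
    then show "(B * Y s) $$ (i, j) = (\<Sum>k<N. B $$ (i, k) * Y s $$ (k, j))"
      using B Yc i j by (intro index_mult_mat_sum) auto
  qed
qed

text \<open>
  Back substitution: the rows are constructed from the last one upwards. In the new row \<open>i0\<close> the
  terms with \<open>k > i0\<close> are already known continuous functions and join the inhomogeneity.
\<close>

lemma triangular_linear_ode_exists:
  fixes T :: "nat \<Rightarrow> nat \<Rightarrow> complex" and g :: "nat \<Rightarrow> real \<Rightarrow> complex"
  assumes g: "\<And>i. i < N \<Longrightarrow> continuous_on {0..} (g i)"
  shows "\<exists>y. \<forall>i<N. y i 0 = c i \<and>
    (\<forall>t\<ge>0. (y i has_vector_derivative (\<Sum>k=i..<N. T i k * y k t) + g i t) (at t within {0..}))"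
proof -
  have "\<exists>y. \<forall>i<N. N - m \<le> i \<longrightarrow> y i 0 = c i \<and>
    (\<forall>t\<ge>0. (y i has_vector_derivative (\<Sum>k=i..<N. T i k * y k t) + g i t) (at t within {0..}))"
    if "m \<le> N" for m
    using that
  proof (induction m)
    case (Suc m)
    then obtain y where y: "\<And>i. i < N \<Longrightarrow> N - m \<le> i \<Longrightarrow> y i 0 = c i"
      "\<And>i t. i < N \<Longrightarrow> N - m \<le> i \<Longrightarrow> t \<ge> 0 \<Longrightarrow>
        (y i has_vector_derivative (\<Sum>k=i..<N. T i k * y k t) + g i t) (at t within {0..})"
      by (metis Suc_leD)
    define i0 where "i0 = N - Suc m"
    have i0: "i0 < N" "N - m = Suc i0" using Suc.prems by (auto simp: i0_def)
    have "continuous_on {0..} (y k)" if "k < N" "Suc i0 \<le> k" for k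
      using y(2)[OF that(1)] that(2) i0(2)
      by (auto simp: continuous_on_eq_continuous_within intro!: has_vector_derivative_continuous)
    then have "continuous_on {0..} (\<lambda>t. (\<Sum>k=Suc i0..<N. T i0 k * y k t) + g i0 t)"
      by (intro continuous_intros g i0) auto
    from scalar_linear_ode_exists[OF this, of "c i0" "T i0 i0"] obtain z where
      z: "z 0 = c i0" "\<And>t. t \<ge> 0 \<Longrightarrow> (z has_vector_derivative
        T i0 i0 * z t + ((\<Sum>k=Suc i0..<N. T i0 k * y k t) + g i0 t)) (at t within {0..})"
      by blast
    have "(y(i0 := z)) i 0 = c i \<and> (\<forall>t\<ge>0. ((y(i0 := z)) i has_vector_derivative
        (\<Sum>k=i..<N. T i k * (y(i0 := z)) k t) + g i t) (at t within {0..}))"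
      if i: "i < N" "N - Suc m \<le> i" for i
    proof (cases "i = i0")
      case True
      have "(\<Sum>k=i0..<N. T i0 k * (y(i0 := z)) k t) =
          T i0 i0 * z t + (\<Sum>k=Suc i0..<N. T i0 k * y k t)" for t
        by (subst sum.atLeast_Suc_lessThan[OF i0(1)]) simp
      with True z show ?thesis by (simp add: add.assoc)
    next
      case False
      with i have i': "N - m \<le> i" "i0 < i" unfolding i0_def by linarith+
      have "(\<Sum>k=i..<N. T i k * (y(i0 := z)) k t) = (\<Sum>k=i..<N. T i k * y k t)" for t
        using i' by (intro sum.cong) auto
      with y[OF i(1) i'(1)] False show ?thesis by simp
    qed
    then show ?case by blast
  qed auto
  from this[of N] show ?thesis by simp
qed

text \<open>
  The equations for different columns of the unknown are uncoupled, so each column is found by back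
  substitution on its own.
\<close>

lemma linear_system_exists_upper_triangular:
  assumes T: "T \<in> carrier_mat N N" "upper_triangular T"
    and F: "\<And>t. t \<ge> 0 \<Longrightarrow> F t \<in> carrier_mat N p"
    and cont: "\<And>i j. i < N \<Longrightarrow> j < p \<Longrightarrow> continuous_on {0..} (\<lambda>t. F t $$ (i, j))"
    and C: "C \<in> carrier_mat N p"
  shows "\<exists>Y. Y 0 = C \<and> linear_system_solution N p T F Y"
proof -
  define solves where "solves j y \<longleftrightarrow> (\<forall>i<N. y i 0 = C $$ (i, j) \<and>
      (\<forall>t\<ge>0. (y i has_vector_derivative
        (\<Sum>k=i..<N. T $$ (i, k) * y k t) + F t $$ (i, j)) (at t within {0..})))" for j y
  have "\<exists>y. solves j y" if "j < p" for j
    unfolding solves_def by (rule triangular_linear_ode_exists) (rule cont[OF _ that])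
  then have "\<exists>y. \<forall>j\<in>{..<p}. solves j (y j)" by (intro bchoice) simp
  then obtain y where "solves j (y j)" if "j < p" for j by auto
  then have y: "\<And>i j. i < N \<Longrightarrow> j < p \<Longrightarrow> y j i 0 = C $$ (i, j)"
      "\<And>i j t. i < N \<Longrightarrow> j < p \<Longrightarrow> t \<ge> 0 \<Longrightarrow> (y j i has_vector_derivative
        (\<Sum>k=i..<N. T $$ (i, k) * y j k t) + F t $$ (i, j)) (at t within {0..})"
    unfolding solves_def by simp_all
  define Y where "Y t = mat N p (\<lambda>(i, j). y j i t)" for t
  have "(T * Y t + F t) $$ (i, j) = (\<Sum>k=i..<N. T $$ (i, k) * y j k t) + F t $$ (i, j)"
    if "t \<ge> 0" "i < N" "j < p" for t i j
  proof -
    have "(T * Y t + F t) $$ (i, j) = (T * Y t) $$ (i, j) + F t $$ (i, j)"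
      using F[OF that(1)] that by simp
    also have "(T * Y t) $$ (i, j) = (\<Sum>k<N. T $$ (i, k) * Y t $$ (k, j))"
      using that by (intro index_mult_mat_sum[OF T(1)]) (auto simp: Y_def)
    also have "\<dots> = (\<Sum>k=i..<N. T $$ (i, k) * y j k t)"
      using that T by (intro sum.mono_neutral_cong_right) (auto simp: Y_def not_le)
    finally show ?thesis .
  qed
  with y(2) have "linear_system_solution N p T F Y"
    by (simp add: linear_system_solution_def Y_def)
  moreover have "Y 0 = C" using C y(1) by (intro eq_matI) (auto simp: Y_def)
  ultimately show ?thesis by blast
qed

text \<open>
  Uniqueness also propagates from the last row upwards: once two solutions agree in all rows below
  row \<open>i\<close>, both \<open>i\<close>-th rows are given by the same scalar formula.
\<close>

lemma linear_system_unique_upper_triangular: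
  assumes T: "T \<in> carrier_mat N N" "upper_triangular T"
    and F: "\<And>t. t \<ge> 0 \<Longrightarrow> F t \<in> carrier_mat N p"
    and Y: "linear_system_solution N p T F Y" and Z: "linear_system_solution N p T F Z"
    and init: "Y 0 = Z 0" and t: "t \<ge> 0"
  shows "Y t = Z t"
proof -
  have row_ode: "((\<lambda>s. X s $$ (i, j)) has_vector_derivative T $$ (i, i) * X s $$ (i, j) +
      ((\<Sum>k=Suc i..<N. T $$ (i, k) * X s $$ (k, j)) + F s $$ (i, j))) (at s within {0..})"
    if "linear_system_solution N p T F X" "i < N" "j < p" "s \<ge> 0" for X i j s
  proof -
    have X: "X s \<in> carrier_mat N p"
      using that by (simp add: linear_system_solution_def)
    have "(T * X s + F s) $$ (i, j) = (\<Sum>k<N. T $$ (i, k) * X s $$ (k, j)) + F s $$ (i, j)"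
      using F[OF that(4)] that index_mult_mat_sum[OF T(1) X that(2,3)] by simp
    also have "(\<Sum>k<N. T $$ (i, k) * X s $$ (k, j)) = (\<Sum>k=i..<N. T $$ (i, k) * X s $$ (k, j))"
      using that T by (intro sum.mono_neutral_cong_right) (auto simp: not_le)
    also have "\<dots> = T $$ (i, i) * X s $$ (i, j) + (\<Sum>k=Suc i..<N. T $$ (i, k) * X s $$ (k, j))"
      by (rule sum.atLeast_Suc_lessThan[OF that(2)])
    finally have rhs: "(T * X s + F s) $$ (i, j) = T $$ (i, i) * X s $$ (i, j) +
        ((\<Sum>k=Suc i..<N. T $$ (i, k) * X s $$ (k, j)) + F s $$ (i, j))"
      by (simp only: add.assoc)
    have "((\<lambda>s. X s $$ (i, j)) has_vector_derivative (T * X s + F s) $$ (i, j)) (at s within {0..})"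
      using that unfolding linear_system_solution_def by blast
    then show ?thesis unfolding rhs .
  qed
  have rows: "\<forall>j<p. \<forall>t\<ge>0. Y t $$ (i, j) = Z t $$ (i, j)" if "i < N" for i
    using that
  proof (induction "N - i" arbitrary: i rule: less_induct)
    case less
    note i = less.prems
    have below: "Y s $$ (k, j) = Z s $$ (k, j)" if "k \<in> {Suc i..<N}" "j < p" "s \<ge> 0" for k j s
      using less.hyps[of k] that diff_less_mono2[of i k N] by simp
    have "Y t $$ (i, j) = Z t $$ (i, j)" if j: "j < p" and t: "t \<ge> 0" for j t
    proof -
      have formula: "X t $$ (i, j) = exp (T $$ (i, i) * of_real t) * X 0 $$ (i, j) +
          integral {0..t} (\<lambda>s. exp (T $$ (i, i) * of_real (t - s)) *
            ((\<Sum>k=Suc i..<N. T $$ (i, k) * X s $$ (k, j)) + F s $$ (i, j)))"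
        if "linear_system_solution N p T F X" for X
        by (rule scalar_linear_ode_formula[OF row_ode[OF that i j] t])
      have s: "(\<Sum>k=Suc i..<N. T $$ (i, k) * Y s $$ (k, j)) =
          (\<Sum>k=Suc i..<N. T $$ (i, k) * Z s $$ (k, j))" if "s \<ge> 0" for s
        by (rule sum.cong[OF refl]) (simp only: below[OF _ j that])
      show ?thesis
        unfolding formula[OF Y] formula[OF Z] init
        by (rule arg_cong2[of _ _ _ _ "(+)", OF refl], rule integral_cong) (simp only: s atLeastAtMost_iff)
    qed
    then show ?case by blast
  qed
  show ?thesis
    using linear_system_solution_carrier[OF Y t] linear_system_solution_carrier[OF Z t] rows t
    by (intro eq_matI) auto
qed

text \<open>
  The characteristic polynomial of a complex matrix splits into linear factors, which is what the
  Schur decomposition needs. Both intertwining relations are recorded: \<open>S\<close> transports a solution of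
  the triangular system to the given one (existence), \<open>R\<close> goes back (uniqueness).
\<close>

lemma similar_upper_triangular:
  fixes M :: "complex mat"
  assumes M: "M \<in> carrier_mat N N"
  obtains T S R where "T \<in> carrier_mat N N" "upper_triangular T"
    "S \<in> carrier_mat N N" "R \<in> carrier_mat N N" "S * R = 1\<^sub>m N" "R * S = 1\<^sub>m N"
    "S * T = M * S" "R * M = T * R"
proof -
  obtain T where T: "T \<in> carrier_mat N N" "upper_triangular T" "similar_mat M T"
    using char_poly_factorized[OF M] schur_decomposition_exists[OF M] by blast
  obtain S R where w: "similar_mat_wit M T S R"
    using T(3) unfolding similar_mat_def by blast
  note SR = similar_mat_witD2[OF M w]
  have "S * T * R * S = S * T * (R * S)"
    using SR(6,7) T(1) by (simp add: assoc_mult_mat[of _ N N _ N _ N])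
  then have 1: "S * T = M * S" using SR(2,6) T(1) by (simp add: SR(3)[symmetric])
  have "R * (S * T * R) = R * S * (T * R)"
    using SR(6,7) T(1) by (simp add: assoc_mult_mat[of _ N N _ N _ N])
  then have 2: "R * M = T * R" using SR(2,7) T(1) by (simp add: SR(3)[symmetric])
  show ?thesis by (rule that[OF T(1,2) SR(6,7,1,2) 1 2])
qed

lemma linear_system_exists:
  assumes M: "M \<in> carrier_mat N N"
    and F: "\<And>t. t \<ge> 0 \<Longrightarrow> F t \<in> carrier_mat N p"
    and cont: "\<And>i j. i < N \<Longrightarrow> j < p \<Longrightarrow> continuous_on {0..} (\<lambda>t. F t $$ (i, j))"
    and C: "C \<in> carrier_mat N p"
  shows "\<exists>Y. Y 0 = C \<and> linear_system_solution N p M F Y"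
proof -
  obtain T S R where T: "T \<in> carrier_mat N N" "upper_triangular T"
    and S: "S \<in> carrier_mat N N" and R: "R \<in> carrier_mat N N"
    and SR: "S * R = 1\<^sub>m N" "R * S = 1\<^sub>m N" and ST: "S * T = M * S" and RM: "R * M = T * R"
    by (rule similar_upper_triangular[OF M])
  have G: "R * F t \<in> carrier_mat N p" if "t \<ge> 0" for t
    using R F[OF that] by simp
  have "continuous_on {0..} (\<lambda>t. (R * F t) $$ (i, j))" if "i < N" "j < p" for i j
  proof -
    have "continuous_on {0..} (\<lambda>t. \<Sum>k<N. R $$ (i, k) * F t $$ (k, j))"
      using cont that by (intro continuous_intros) auto
    then show ?thesis
      by (rule continuous_on_eq) (use index_mult_mat_sum[OF R F that] in auto)
  qed
  from linear_system_exists_upper_triangular[OF T G this, of "R * C"] R C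
  obtain Z where Z: "Z 0 = R * C" "linear_system_solution N p T (\<lambda>t. R * F t) Z" by auto
  have "linear_system_solution N p M (\<lambda>t. S * (R * F t)) (\<lambda>t. S * Z t)"
    by (rule linear_system_solution_change_variables[OF Z(2) T(1) M S G ST])
  moreover have cancel: "S * (R * D) = D" if "D \<in> carrier_mat N p" for D
    using S R SR that by (simp add: assoc_mult_mat[symmetric, of _ N N _ N _ p])
  ultimately have "linear_system_solution N p M F (\<lambda>t. S * Z t)"
    using F by (simp add: linear_system_solution_def)
  moreover have "S * Z 0 = C" using cancel[OF C] Z(1) by simp
  ultimately show ?thesis by (intro exI[of _ "\<lambda>t. S * Z t"] conjI)
qed

lemma linear_system_unique:
  assumes M: "M \<in> carrier_mat N N"
    and F: "\<And>t. t \<ge> 0 \<Longrightarrow> F t \<in> carrier_mat N p"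
    and Y: "linear_system_solution N p M F Y" and Z: "linear_system_solution N p M F Z"
    and init: "Y 0 = Z 0" and t: "t \<ge> 0"
  shows "Y t = Z t"
proof -
  obtain T S R where T: "T \<in> carrier_mat N N" "upper_triangular T"
    and S: "S \<in> carrier_mat N N" and R: "R \<in> carrier_mat N N"
    and SR: "S * R = 1\<^sub>m N" "R * S = 1\<^sub>m N" and ST: "S * T = M * S" and RM: "R * M = T * R"
    by (rule similar_upper_triangular[OF M])
  have RF: "R * F s \<in> carrier_mat N p" if "s \<ge> 0" for s
    using R F[OF that] by simp
  have RY: "linear_system_solution N p T (\<lambda>t. R * F t) (\<lambda>t. R * Y t)"
    by (rule linear_system_solution_change_variables[OF Y M T(1) R F RM])
  have RZ: "linear_system_solution N p T (\<lambda>t. R * F t) (\<lambda>t. R * Z t)"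
    by (rule linear_system_solution_change_variables[OF Z M T(1) R F RM])
  have "R * Y 0 = R * Z 0" by (simp only: init)
  from linear_system_unique_upper_triangular[OF T RF RY RZ this t]
  have RYZ: "R * Y t = R * Z t" .
  note c = linear_system_solution_carrier[OF Y t] linear_system_solution_carrier[OF Z t]
  from RYZ have "S * R * Y t = S * R * Z t"
    using S R c by (simp add: assoc_mult_mat[of _ N N _ N _ p])
  then show ?thesis using c by (simp add: SR)
qed

section \<open>Distinct eigenvalues\<close>

lemma eigenvector_cols_diag:
  fixes A P :: "'a :: field mat"
  assumes A: "A \<in> carrier_mat N N" and P: "P \<in> carrier_mat N N"
    and eig: "\<And>j. j < N \<Longrightarrow> eigenvector A (col P j) (l j)"
  shows "A * P = P * mat_diag N l"
proof (rule eq_matI)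
  have D: "mat_diag N l \<in> carrier_mat N N" by simp
  fix i j assume "i < dim_row (P * mat_diag N l)" "j < dim_col (P * mat_diag N l)"
  then have ij: "i < N" "j < N" using P carrier_matD[OF D] by auto
  have "(A * P) $$ (i, j) = (A *\<^sub>v col P j) $ i" using ij A P by simp
  also have "\<dots> = P $$ (i, j) * l j"
    using eig[OF ij(2)] ij P by (simp add: eigenvector_def mult.commute)
  also have "\<dots> = (P * mat_diag N l) $$ (i, j)"
    using ij by (simp add: mat_diag_mult_right[OF P])
  finally show "(A * P) $$ (i, j) = (P * mat_diag N l) $$ (i, j)" .
qed (use A P in \<open>auto simp: mat_diag_def\<close>)

text \<open>
  Independence of eigenvectors for distinct eigenvalues, by induction on the size of the support of a
  relation \<open>v\<close>. For \<open>j0\<close> in the support, \<open>(D - l j0) v\<close> with \<open>D\<close> the diagonal matrix of eigenvalues is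
  again a relation because \<open>P D = A P\<close>, and its support is that of \<open>v\<close> without \<open>j0\<close>.
\<close>

lemma eigenvector_cols_kernel:
  fixes A P :: "'a :: field mat"
  assumes A: "A \<in> carrier_mat N N" and P: "P \<in> carrier_mat N N"
    and eig: "\<And>j. j < N \<Longrightarrow> eigenvector A (col P j) (l j)"
    and inj: "inj_on l {..<N}"
    and v: "v \<in> carrier_vec N" and Pv: "P *\<^sub>v v = 0\<^sub>v N"
  shows "v = 0\<^sub>v N"
  using v Pv
proof (induction "card {j. j < N \<and> v $ j \<noteq> 0}" arbitrary: v rule: less_induct)
  case less
  have AP: "A * P = P * mat_diag N l"
    by (rule eigenvector_cols_diag[OF A P eig])
  show ?case
  proof (rule ccontr)
    assume "v \<noteq> 0\<^sub>v N"
    then obtain j0 where j0: "j0 < N" "v $ j0 \<noteq> 0"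
      using less.prems(1) by (metis carrier_vecD eq_vecI index_zero_vec)
    \<comment> \<open>the entry \<open>j0\<close> of \<open>d\<close> vanishes and, as the eigenvalues are distinct, no other entry is lost\<close>
    define d where "d = mat_diag N l *\<^sub>v v - l j0 \<cdot>\<^sub>v v"
    have Dv: "(mat_diag N l *\<^sub>v v) $ j = l j * v $ j" if "j < N" for j
      using that less.prems(1) unfolding mat_diag_def
      by (simp add: scalar_prod_def if_distrib[of "\<lambda>x. x * _"] cong: if_cong)
    have Dc: "mat_diag N l *\<^sub>v v \<in> carrier_vec N"
      by (rule mult_mat_vec_carrier[OF mat_diag_dim less.prems(1)])
    have d: "d \<in> carrier_vec N" "\<And>j. j < N \<Longrightarrow> d $ j = (l j - l j0) * v $ j"
      using less.prems(1) Dc Dv by (auto simp: d_def algebra_simps)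
    have "P *\<^sub>v d = P *\<^sub>v (mat_diag N l *\<^sub>v v) - l j0 \<cdot>\<^sub>v (P *\<^sub>v v)"
      unfolding d_def using less.prems(1) Dc P
      by (simp add: mult_minus_distrib_mat_vec[of _ N N] mult_mat_vec[of _ N N])
    also have "P *\<^sub>v (mat_diag N l *\<^sub>v v) = A *\<^sub>v (P *\<^sub>v v)"
      using assoc_mult_mat_vec[OF P mat_diag_dim less.prems(1), of l]
        assoc_mult_mat_vec[OF A P less.prems(1)] AP by simp
    finally have "P *\<^sub>v d = 0\<^sub>v N"
      unfolding less.prems(2) using A by auto
    moreover have "card {j. j < N \<and> d $ j \<noteq> 0} < card {j. j < N \<and> v $ j \<noteq> 0}"
    proof (rule psubset_card_mono)
      have "v $ j \<noteq> 0" if "j < N" "d $ j \<noteq> 0" for j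
        using that(2) unfolding d(2)[OF that(1)] by simp
      moreover have "d $ j0 = 0" using d(2)[OF j0(1)] by simp
      ultimately show "{j. j < N \<and> d $ j \<noteq> 0} \<subset> {j. j < N \<and> v $ j \<noteq> 0}"
        using j0 by blast
    qed simp
    ultimately have "d = 0\<^sub>v N" using less.hyps d(1) by blast
    then have vj: "v $ j = 0" if "j < N" "j \<noteq> j0" for j
      using d(2)[OF that(1)] that inj_onD[OF inj, of j j0] j0(1) by auto
    \<comment> \<open>only the entry \<open>j0\<close> of \<open>v\<close> is left, so the eigenvector in column \<open>j0\<close> would vanish\<close>
    have "P $$ (i, j0) * v $ j0 = (P *\<^sub>v v) $ i" if "i < N" for i
    proof -
      have "(P *\<^sub>v v) $ i = (\<Sum>j\<in>{0..<N}. P $$ (i, j) * v $ j)"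
        using P less.prems(1) that by (simp add: scalar_prod_def)
      also have "\<dots> = (\<Sum>j\<in>{j0}. P $$ (i, j) * v $ j)"
        using vj j0(1) by (intro sum.mono_neutral_right) auto
      finally show ?thesis by simp
    qed
    then have "P $$ (i, j0) = 0" if "i < N" for i
      using less.prems(2) that j0 by simp
    then have "col P j0 = 0\<^sub>v N" using P j0 by (intro eq_vecI) auto
    then show False using eig[OF j0(1)] A by (simp add: eigenvector_def)
  qed
qed

lemma eigenvector_cols_inverse:
  fixes A P :: "'a :: field mat"
  assumes A: "A \<in> carrier_mat N N" and P: "P \<in> carrier_mat N N"
    and eig: "\<And>j. j < N \<Longrightarrow> eigenvector A (col P j) (l j)"
    and inj: "inj_on l {..<N}"
  obtains Q where "Q \<in> carrier_mat N N" "P * Q = 1\<^sub>m N" "Q * P = 1\<^sub>m N"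
    "Q * A = mat_diag N l * Q"
proof -
  have "det P \<noteq> 0"
    using det_0_iff_vec_prod_zero[OF P] eigenvector_cols_kernel[OF A P eig inj] by blast
  from det_non_zero_imp_unit[OF P this, of "()"] obtain Q where
    Q: "Q \<in> carrier_mat N N" "P * Q = 1\<^sub>m N" "Q * P = 1\<^sub>m N"
    by (auto simp: Units_def ring_mat_def)
  have D: "mat_diag N l \<in> carrier_mat N N" by simp
  have AP: "A * P = P * mat_diag N l"
    by (rule eigenvector_cols_diag[OF A P eig])
  have "Q * A = Q * (A * P) * Q"
    using Q A P by (simp add: assoc_mult_mat[of _ N N _ N _ N])
  also have "\<dots> = (Q * P) * mat_diag N l * Q"
    unfolding AP using Q(1) P D by (simp add: assoc_mult_mat[of _ N N _ N _ N])
  finally have "Q * A = mat_diag N l * Q" using Q(3) D by simp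
  with Q show ?thesis by (rule that)
qed

text \<open>
  Two indices with the same eigenvalue belong to the same mode, since the quadratic equation recovers
  \<open>mu\<close> from \<open>lam\<close>. If they differ, they are the two branches of one mode, whose difference is the
  square root of the discriminant.
\<close>

lemma inj_on_lam:
  assumes disc: "\<forall>k\<in>{1..n - 2}. \<beta>\<^sup>2 + 4 * mu n k \<noteq> 0"
  shows "inj_on (lam n \<beta>) {..<2 * n - 4}"
proof (rule inj_onI)
  fix i j assume ij: "i \<in> {..<2 * n - 4}" "j \<in> {..<2 * n - 4}" and eq: "lam n \<beta> i = lam n \<beta> j"
  have mode: "1 \<le> mode n k" "mode n k \<le> n - 2" if "k \<in> {..<2 * n - 4}" for k
    using that by (auto simp: mode_def)
  have "complex_of_real (mu n (mode n i)) = of_real (mu n (mode n j))"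
    using lam_quadratic[of n \<beta> i] lam_quadratic[of n \<beta> j] by (simp add: eq)
  then have "cos (real (mode n i) * pi / real (n - 1)) = cos (real (mode n j) * pi / real (n - 1))"
    by (simp add: mu_def)
  moreover have bounds: "0 \<le> real (mode n k) * pi / real (n - 1)"
      "real (mode n k) * pi / real (n - 1) \<le> pi" if "k \<in> {..<2 * n - 4}" for k
  proof -
    have "real (mode n k) \<le> real (n - 1)" "0 < real (n - 1)" using mode[OF that] by auto
    then have "real (mode n k) / real (n - 1) \<le> 1" by simp
    from mult_right_mono[OF this, of pi]
    show "real (mode n k) * pi / real (n - 1) \<le> pi" by simp
  qed simp
  ultimately have "real (mode n i) * pi / real (n - 1) = real (mode n j) * pi / real (n - 1)"
    using cos_inj_pi[OF bounds[OF ij(1)] bounds[OF ij(2)]] by (simp only:)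
  moreover have "real (n - 1) \<noteq> 0" using mode[OF ij(1)] by auto
  ultimately have m: "mode n i = mode n j" by simp
  show "i = j"
  proof (cases "i < n - 2 \<longleftrightarrow> j < n - 2")
    case True
    with m show ?thesis by (auto simp: mode_def split: if_splits)
  next
    case False
    define r where "r = csqrt (of_real (\<beta>\<^sup>2 + 4 * mu n (mode n j)))"
    from False eq have "(- of_real \<beta> + r) / 2 = (- of_real \<beta> - r) / 2"
      by (auto simp: lam_def m r_def Let_def)
    then have "r = 0" by (simp add: eq_neg_iff_add_eq_0)
    then have "complex_of_real (\<beta>\<^sup>2 + 4 * mu n (mode n j)) = 0" unfolding r_def by (simp only: csqrt_eq_0)
    then have "\<beta>\<^sup>2 + 4 * mu n (mode n j) = 0" by (simp only: of_real_eq_0_iff)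
    with disc mode[OF ij(2)] show ?thesis by auto
  qed
qed

section \<open>Diagonal systems\<close>

lemma diagonal_system_formula:
  assumes Z: "linear_system_solution N p (mat_diag N l) G Z"
    and G: "\<And>s. s \<ge> 0 \<Longrightarrow> G s \<in> carrier_mat N p" and t: "t \<ge> 0"
  shows "Z t = mat_diag N (\<lambda>i. exp (l i * of_real t)) * Z 0
    + mat_integral 0 t (\<lambda>s. mat_diag N (\<lambda>i. exp (l i * of_real (t - s))) * G s)"
proof (rule eq_matI)
  note Zc = linear_system_solution_carrier[OF Z]
  let ?E = "\<lambda>s. mat_diag N (\<lambda>i. exp (l i * complex_of_real s))"
  have EG: "?E (t - s) * G s = mat N p (\<lambda>(i, j). exp (l i * of_real (t - s)) * G s $$ (i, j))"
    if "s \<ge> 0" for s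
    by (rule mat_diag_mult_left[OF G[OF that]])
  have EZ: "?E t * Z 0 = mat N p (\<lambda>(i, j). exp (l i * of_real t) * Z 0 $$ (i, j))"
    by (rule mat_diag_mult_left[OF Zc]) simp
  let ?R = "?E t * Z 0 + mat_integral 0 t (\<lambda>s. ?E (t - s) * G s)"
  have dims: "dim_row (mat_integral 0 t (\<lambda>s. ?E (t - s) * G s)) = N"
    "dim_col (mat_integral 0 t (\<lambda>s. ?E (t - s) * G s)) = p"
    unfolding mat_integral_def EG[OF order_refl] by simp_all
  then show "dim_row (Z t) = dim_row ?R" "dim_col (Z t) = dim_col ?R"
    using Zc[OF t] by simp_all
  fix i j assume "i < dim_row ?R" "j < dim_col ?R"
  with dims have ij: "i < N" "j < p" by simp_all
  have ode: "((\<lambda>s. Z s $$ (i, j)) has_vector_derivative l i * Z s $$ (i, j) + G s $$ (i, j))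
      (at s within {0..})" if "s \<ge> 0" for s
  proof -
    have "(mat_diag N l * Z s + G s) $$ (i, j) = l i * Z s $$ (i, j) + G s $$ (i, j)"
      unfolding mat_diag_mult_left[OF Zc[OF that]] using G[OF that] ij by simp
    then show ?thesis using Z that ij unfolding linear_system_solution_def by metis
  qed
  have "mat_integral 0 t (\<lambda>s. ?E (t - s) * G s) $$ (i, j) =
      integral {0..t} (\<lambda>s. (?E (t - s) * G s) $$ (i, j))"
    unfolding mat_integral_def EG[OF order_refl] using ij by simp
  also have "\<dots> = integral {0..t} (\<lambda>s. exp (l i * of_real (t - s)) * G s $$ (i, j))"
  proof (rule integral_cong)
    fix s assume "s \<in> {0..t}"
    then show "(?E (t - s) * G s) $$ (i, j) = exp (l i * of_real (t - s)) * G s $$ (i, j)"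
      using ij by (subst EG) simp_all
  qed
  finally have I: "mat_integral 0 t (\<lambda>s. ?E (t - s) * G s) $$ (i, j) = \<dots>" .
  have "Z t $$ (i, j) = exp (l i * of_real t) * Z 0 $$ (i, j) +
      integral {0..t} (\<lambda>s. exp (l i * of_real (t - s)) * G s $$ (i, j))"
    by (rule scalar_linear_ode_formula[OF ode t])
  then show "Z t $$ (i, j) = ?R $$ (i, j)"
    using ij dims by (simp only: EZ I index_add_mat(1) index_mat prod.case)
qed

section \<open>The flow as a first-order system\<close>

text \<open>
  The matrix of the first-order system, kept over the reals so that solutions can be moved between
  the real flow and the complex linear theory.
\<close>

definition real_system_mat :: "nat \<Rightarrow> real \<Rightarrow> real mat" where
  "real_system_mat m \<beta> =
     four_block_mat (0\<^sub>m m m) (1\<^sub>m m) (tridiag_mat m 1 (-2) 1) (- \<beta> \<cdot>\<^sub>m 1\<^sub>m m)"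

lemma tridiag_mat_carrier [simp]: "tridiag_mat m a b c \<in> carrier_mat m m"
  by (simp add: tridiag_mat_def)

lemma real_system_mat_carrier: "real_system_mat m \<beta> \<in> carrier_mat (m + m) (m + m)"
  unfolding real_system_mat_def by (intro four_block_carrier_mat) auto

lemma cmat_real_system_mat: "cmat (real_system_mat (n - 2) \<beta>) = system_mat n \<beta>"
proof -
  have "cmat (tridiag_mat (n - 2) 1 (-2) 1) = tridiag_mat (n - 2) 1 (-2) 1"
    by (intro eq_matI) (auto simp: tridiag_mat_def)
  moreover have "cmat (- \<beta> \<cdot>\<^sub>m 1\<^sub>m (n - 2)) = - of_real \<beta> \<cdot>\<^sub>m 1\<^sub>m (n - 2)"
    by (intro eq_matI) auto
  moreover have "cmat (0\<^sub>m (n - 2) (n - 2)) = 0\<^sub>m (n - 2) (n - 2)" "cmat (1\<^sub>m (n - 2)) = 1\<^sub>m (n - 2)"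
    by (auto intro: eq_matI)
  ultimately show ?thesis
    unfolding real_system_mat_def system_mat_def
    by (subst map_four_block_mat[of _ "n - 2" "n - 2" _ "n - 2" _ "n - 2"]) simp_all
qed

lemma system_mat_carrier: "system_mat n \<beta> \<in> carrier_mat (n - 2 + (n - 2)) (n - 2 + (n - 2))"
  unfolding cmat_real_system_mat[symmetric] using real_system_mat_carrier[of "n - 2" \<beta>] by simp

lemma index_append_rows:
  assumes "A \<in> carrier_mat m p" "B \<in> carrier_mat k p" "i < m + k" "j < p"
  shows "(A @\<^sub>r B) $$ (i, j) = (if i < m then A $$ (i, j) else B $$ (i - m, j))"
  using assms unfolding append_rows_def by auto

lemma append_rows_add:
  fixes A :: "'a :: monoid_add mat"
  assumes "A \<in> carrier_mat m p" "B \<in> carrier_mat k p" "C \<in> carrier_mat m p" "D \<in> carrier_mat k p"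
  shows "(A @\<^sub>r B) + (C @\<^sub>r D) = (A + C) @\<^sub>r (B + D)"
  using assms unfolding append_rows_def by (intro eq_matI) auto

text \<open>
  The block form of the right-hand side: the top half says \<open>U' = V\<close>, the bottom half is the
  acceleration \<open>A U + B - \<beta> V\<close> that the second-order equation prescribes.
\<close>

lemma real_system_mat_mult_append_rows:
  assumes U: "U \<in> carrier_mat m p" and V: "V \<in> carrier_mat m p" and B: "B \<in> carrier_mat m p"
  shows "real_system_mat m \<beta> * (U @\<^sub>r V) + (0\<^sub>m m p @\<^sub>r B) =
    V @\<^sub>r (tridiag_mat m 1 (-2) 1 * U + B - \<beta> \<cdot>\<^sub>m V)"
proof -
  let ?A = "tridiag_mat m 1 (-2) (1 :: real)"
  have A: "?A \<in> carrier_mat m m" by simp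
  have c: "0\<^sub>m m m \<in> carrier_mat m m" "1\<^sub>m m \<in> carrier_mat m m"
    "- \<beta> \<cdot>\<^sub>m 1\<^sub>m m \<in> carrier_mat m m" by auto
  have z: "0\<^sub>m (dim_row U) 0 \<in> carrier_mat m 0" "0\<^sub>m (dim_row V) 0 \<in> carrier_mat m 0"
    using U V by auto
  have AU: "?A * U \<in> carrier_mat m p" by (rule mult_carrier_mat[OF A U])
  have b: "(- \<beta> \<cdot>\<^sub>m 1\<^sub>m m) * V = - \<beta> \<cdot>\<^sub>m V"
    using V by (subst mult_smult_assoc_mat[of _ m m _ p]) simp_all
  have "real_system_mat m \<beta> * (U @\<^sub>r V) = V @\<^sub>r (?A * U + - \<beta> \<cdot>\<^sub>m V)"
    unfolding real_system_mat_def append_rows_def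
      mult_four_block_mat[OF c(1,2) A c(3) U z(1) V z(2)] b
    using U V AU by (intro arg_cong2[of _ _ _ _ "\<lambda>a b. four_block_mat a _ b _"] eq_matI) auto
  moreover have "(V @\<^sub>r (?A * U + - \<beta> \<cdot>\<^sub>m V)) + (0\<^sub>m m p @\<^sub>r B) =
      (V + 0\<^sub>m m p) @\<^sub>r (?A * U + - \<beta> \<cdot>\<^sub>m V + B)"
    by (rule append_rows_add) (use V AU B in auto)
  moreover have "V + 0\<^sub>m m p = V" using V by simp
  moreover have "?A * U + - \<beta> \<cdot>\<^sub>m V + B = ?A * U + B - \<beta> \<cdot>\<^sub>m V"
    using V B AU by (intro eq_matI) (auto simp del: index_mult_mat(1))
  ultimately show ?thesis by simp
qed

lemma has_mat_derivative_append_rows: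
  assumes U: "\<And>s. s \<in> S \<Longrightarrow> U s \<in> carrier_mat m p" and V: "\<And>s. s \<in> S \<Longrightarrow> V s \<in> carrier_mat k p"
    and C: "C \<in> carrier_mat m p" and D: "D \<in> carrier_mat k p" and t: "t \<in> S"
  shows "has_mat_derivative (\<lambda>s. U s @\<^sub>r V s) (C @\<^sub>r D) (at t within S) \<longleftrightarrow>
    has_mat_derivative U C (at t within S) \<and> has_mat_derivative V D (at t within S)"
proof -
  have transform: "((\<lambda>s. f s) has_real_derivative d) (at t within S) \<longleftrightarrow>
      ((\<lambda>s. g s) has_real_derivative d) (at t within S)"
    if "\<And>s. s \<in> S \<Longrightarrow> f s = g s" for f g :: "real \<Rightarrow> real" and d
    using that t by (intro has_field_derivative_cong_eventually) (auto simp: eventually_at_filter)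
  have top: "((\<lambda>s. (U s @\<^sub>r V s) $$ (i, j)) has_real_derivative (C @\<^sub>r D) $$ (i, j)) (at t within S) \<longleftrightarrow>
      ((\<lambda>s. U s $$ (i, j)) has_real_derivative C $$ (i, j)) (at t within S)"
    if "i < m" "j < p" for i j
  proof -
    have "(C @\<^sub>r D) $$ (i, j) = C $$ (i, j)"
      using that by (simp add: index_append_rows[OF C D])
    note CD = this
    have "(U s @\<^sub>r V s) $$ (i, j) = U s $$ (i, j)" if "s \<in> S" for s
      using \<open>i < m\<close> \<open>j < p\<close> by (simp add: index_append_rows[OF U[OF that] V[OF that]])
    then show ?thesis unfolding CD by (rule transform)
  qed
  have bot: "((\<lambda>s. (U s @\<^sub>r V s) $$ (m + i, j)) has_real_derivative (C @\<^sub>r D) $$ (m + i, j)) (at t within S) \<longleftrightarrow>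
      ((\<lambda>s. V s $$ (i, j)) has_real_derivative D $$ (i, j)) (at t within S)"
    if "i < k" "j < p" for i j
  proof -
    have "(C @\<^sub>r D) $$ (m + i, j) = D $$ (i, j)"
      using that by (simp add: index_append_rows[OF C D])
    note CD = this
    have "(U s @\<^sub>r V s) $$ (m + i, j) = V s $$ (i, j)" if "s \<in> S" for s
      using \<open>i < k\<close> \<open>j < p\<close> by (simp add: index_append_rows[OF U[OF that] V[OF that]])
    then show ?thesis unfolding CD by (rule transform)
  qed
  have split: "(\<forall>i<m + k. Q i) \<longleftrightarrow> (\<forall>i<m. Q i) \<and> (\<forall>i<k. Q (m + i))" for Q
    by (metis add_less_cancel_left le_add_diff_inverse not_less trans_less_add1)
  show ?thesis
    unfolding has_mat_derivative_def carrier_matD[OF carrier_append_rows[OF C D]] carrier_matD[OF C]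
      carrier_matD[OF D] split
    using top bot by simp
qed

lemma interior_mat_carrier: "X \<in> carrier_mat n p \<Longrightarrow> interior_mat X \<in> carrier_mat (n - 2) p"
  by (auto simp: interior_mat_def)

lemma boundary_mat_carrier:
  "a \<in> carrier_vec p \<Longrightarrow> b \<in> carrier_vec p \<Longrightarrow> boundary_mat m a b \<in> carrier_mat m p"
  by (auto simp: boundary_mat_def row_mat_def)

text \<open>
  The acceleration \<open>W\<close> is only asserted to exist, but the equation of motion determines it, which
  turns the second-order equation into the bottom half of the first-order system.
\<close>

lemma flow_iff_first_order:
  assumes U: "\<And>s. s \<ge> 0 \<Longrightarrow> U s \<in> carrier_mat m p" and V: "\<And>s. s \<ge> 0 \<Longrightarrow> V s \<in> carrier_mat m p"
    and B: "B \<in> carrier_mat m p" and t: "t \<ge> 0"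
  shows "has_mat_derivative (\<lambda>s. U s @\<^sub>r V s) (real_system_mat m \<beta> * (U t @\<^sub>r V t) + (0\<^sub>m m p @\<^sub>r B))
      (at t within {0..}) \<longleftrightarrow>
    has_mat_derivative U (V t) (at t within {0..}) \<and>
    (\<exists>W \<in> carrier_mat m p. has_mat_derivative V W (at t within {0..}) \<and>
       W + \<beta> \<cdot>\<^sub>m V t = tridiag_mat m 1 (-2) 1 * U t + B)"
proof -
  define R where "R = tridiag_mat m 1 (-2) 1 * U t + B"
  have Rc: "R \<in> carrier_mat m p" using B U[OF t] by (simp add: R_def)
  have W: "W + \<beta> \<cdot>\<^sub>m V t = R \<longleftrightarrow> W = R - \<beta> \<cdot>\<^sub>m V t" if "W \<in> carrier_mat m p" for W
    using that Rc V[OF t] by (auto simp: mat_eq_iff eq_diff_eq)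
  have D: "R - \<beta> \<cdot>\<^sub>m V t \<in> carrier_mat m p" using Rc V[OF t] by auto
  have eq: "has_mat_derivative (\<lambda>s. U s @\<^sub>r V s) (V t @\<^sub>r (R - \<beta> \<cdot>\<^sub>m V t)) (at t within {0..}) \<longleftrightarrow>
      has_mat_derivative U (V t) (at t within {0..}) \<and>
      has_mat_derivative V (R - \<beta> \<cdot>\<^sub>m V t) (at t within {0..})"
    by (rule has_mat_derivative_append_rows) (use U V D t in auto)
  have "(\<exists>W \<in> carrier_mat m p. has_mat_derivative V W (at t within {0..}) \<and> W + \<beta> \<cdot>\<^sub>m V t = R) \<longleftrightarrow>
      has_mat_derivative V (R - \<beta> \<cdot>\<^sub>m V t) (at t within {0..})"
  proof
    assume "\<exists>W \<in> carrier_mat m p. has_mat_derivative V W (at t within {0..}) \<and> W + \<beta> \<cdot>\<^sub>m V t = R"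
    then show "has_mat_derivative V (R - \<beta> \<cdot>\<^sub>m V t) (at t within {0..})"
      using W by auto
  next
    assume "has_mat_derivative V (R - \<beta> \<cdot>\<^sub>m V t) (at t within {0..})"
    then show "\<exists>W \<in> carrier_mat m p. has_mat_derivative V W (at t within {0..}) \<and> W + \<beta> \<cdot>\<^sub>m V t = R"
      using W[OF D] by (intro bexI[OF _ D]) simp
  qed
  then show ?thesis
    unfolding real_system_mat_mult_append_rows[OF U[OF t] V[OF t] B] R_def[symmetric] eq by simp
qed

section \<open>Passing between real and complex systems\<close>

lemma linear_system_solution_cmat:
  assumes R: "\<And>t. t \<ge> 0 \<Longrightarrow> R t \<in> carrier_mat N p"
    and A: "A \<in> carrier_mat N N" and G: "\<And>t. t \<ge> 0 \<Longrightarrow> G t \<in> carrier_mat N p"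
    and ode: "\<And>t. t \<ge> 0 \<Longrightarrow> has_mat_derivative R (A * R t + G t) (at t within {0..})"
  shows "linear_system_solution N p (cmat A) (\<lambda>t. cmat (G t)) (\<lambda>t. cmat (R t))"
  unfolding linear_system_solution_def
proof (intro allI impI conjI)
  fix t :: real assume t: "t \<ge> 0"
  show "cmat (R t) \<in> carrier_mat N p" using R[OF t] by simp
  fix i j assume ij: "i < N" "j < p"
  have c: "A * R t + G t \<in> carrier_mat N p" using A R[OF t] G[OF t] by simp
  have "((\<lambda>s. R s $$ (i, j)) has_real_derivative (A * R t + G t) $$ (i, j)) (at t within {0..})"
    using ode[OF t] ij carrier_matD[OF c] by (simp add: has_mat_derivative_def)
  then have "((\<lambda>s. complex_of_real (R s $$ (i, j))) has_vector_derivative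
      of_real ((A * R t + G t) $$ (i, j))) (at t within {0..})"
    by (rule has_vector_derivative_of_real)
  also have "of_real ((A * R t + G t) $$ (i, j)) = cmat (A * R t + G t) $$ (i, j)"
    using ij carrier_matD[OF c] by simp
  also have "cmat (A * R t + G t) = cmat A * cmat (R t) + cmat (G t)"
  proof -
    have "cmat (A * R t + G t) = cmat (A * R t) + cmat (G t)"
      using A R[OF t] G[OF t] by (intro eq_matI) auto
    then show ?thesis by (simp only: of_real_hom.mat_hom_mult[OF A R[OF t]])
  qed
  finally show "((\<lambda>s. cmat (R s) $$ (i, j)) has_vector_derivative
      (cmat A * cmat (R t) + cmat (G t)) $$ (i, j)) (at t within {0..})"
  proof (rule has_vector_derivative_transform[rotated 2])
    show "t \<in> {0..}" using t by simp
    fix s :: real assume "s \<in> {0..}"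
    then have "R s \<in> carrier_mat N p" by (simp add: R)
    then show "cmat (R s) $$ (i, j) = complex_of_real (R s $$ (i, j))"
      using ij by simp
  qed
qed

text \<open>Taking real parts commutes with multiplication by a real matrix and with differentiation.\<close>

lemma real_part_solution:
  assumes Y: "linear_system_solution N p (cmat A) (\<lambda>t. cmat (G t)) Y"
    and A: "A \<in> carrier_mat N N" and G: "\<And>t. t \<ge> 0 \<Longrightarrow> G t \<in> carrier_mat N p" and t: "t \<ge> 0"
  shows "has_mat_derivative (\<lambda>s. map_mat Re (Y s)) (A * map_mat Re (Y t) + G t) (at t within {0..})"
  unfolding has_mat_derivative_def
proof (intro allI impI)
  note Yc = linear_system_solution_carrier[OF Y]
  have c: "A * map_mat Re (Y t) + G t \<in> carrier_mat N p" "cmat A * Y t \<in> carrier_mat N p"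
    using A Yc[OF t] G[OF t] by auto
  fix i j
  assume "i < dim_row (A * map_mat Re (Y t) + G t)" "j < dim_col (A * map_mat Re (Y t) + G t)"
  then have ij: "i < N" "j < p" unfolding carrier_matD[OF c(1)] .
  have "((\<lambda>s. Y s $$ (i, j)) has_vector_derivative (cmat A * Y t + cmat (G t)) $$ (i, j))
      (at t within {0..})"
    using Y t ij unfolding linear_system_solution_def by blast
  from bounded_linear.has_vector_derivative[OF bounded_linear_Re this]
  have "((\<lambda>s. Re (Y s $$ (i, j))) has_real_derivative Re ((cmat A * Y t + cmat (G t)) $$ (i, j)))
      (at t within {0..})"
    by (simp only: has_real_derivative_iff_has_vector_derivative)
  also have "Re ((cmat A * Y t + cmat (G t)) $$ (i, j)) = (A * map_mat Re (Y t) + G t) $$ (i, j)"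
  proof -
    have "(cmat A * Y t) $$ (i, j) = (\<Sum>k<N. cmat A $$ (i, k) * Y t $$ (k, j))"
      using A Yc[OF t] ij by (intro index_mult_mat_sum) auto
    moreover have "(A * map_mat Re (Y t)) $$ (i, j) = (\<Sum>k<N. A $$ (i, k) * map_mat Re (Y t) $$ (k, j))"
      using A Yc[OF t] ij by (intro index_mult_mat_sum) auto
    ultimately show ?thesis
      using A Yc[OF t] G[OF t] ij by (simp del: index_mult_mat)
  qed
  finally show "((\<lambda>s. map_mat Re (Y s) $$ (i, j)) has_real_derivative
      (A * map_mat Re (Y t) + G t) $$ (i, j)) (at t within {0..})"
  proof (rule has_field_derivative_transform_within[where d = 1])
    show "t \<in> {0..}" using t by simp
    show "(0 :: real) < 1" by simp
    fix s :: real assume "s \<in> {0..}"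
    then have "Y s \<in> carrier_mat N p" by (simp add: Yc)
    then show "Re (Y s $$ (i, j)) = map_mat Re (Y s) $$ (i, j)"
      using ij by simp
  qed
qed

section \<open>Existence and uniqueness of the flow\<close>

lemma hyperbolic_flow_solution_iff:
  assumes f: "\<forall>t\<ge>0. f\<^sub>1 t \<in> carrier_vec p \<and> f\<^sub>n t \<in> carrier_vec p"
  shows "hyperbolic_flow_solution n p \<beta> f\<^sub>1 f\<^sub>n X\<^sub>0 V\<^sub>0 X V \<longleftrightarrow>
    (\<forall>t\<ge>0. X t \<in> carrier_mat n p \<and> V t \<in> carrier_mat (n - 2) p) \<and>
    X 0 = X\<^sub>0 \<and> V 0 = V\<^sub>0 \<and>
    (\<forall>t\<ge>0. row (X t) 0 = f\<^sub>1 t \<and> row (X t) (n - 1) = f\<^sub>n t) \<and>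
    (\<forall>t\<ge>0. has_mat_derivative (\<lambda>s. interior_mat (X s) @\<^sub>r V s)
      (real_system_mat (n - 2) \<beta> * (interior_mat (X t) @\<^sub>r V t) + forcing_mat n p f\<^sub>1 f\<^sub>n t)
      (at t within {0..}))"
proof -
  have "(\<forall>t\<ge>0. has_mat_derivative (\<lambda>s. interior_mat (X s) @\<^sub>r V s)
      (real_system_mat (n - 2) \<beta> * (interior_mat (X t) @\<^sub>r V t) + forcing_mat n p f\<^sub>1 f\<^sub>n t)
      (at t within {0..})) \<longleftrightarrow>
    (\<forall>t\<ge>0. has_mat_derivative (\<lambda>s. interior_mat (X s)) (V t) (at t within {0..}) \<and>
     (\<exists>W \<in> carrier_mat (n - 2) p. has_mat_derivative V W (at t within {0..}) \<and>
        W + \<beta> \<cdot>\<^sub>m V t =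
          tridiag_mat (n - 2) 1 (-2) 1 * interior_mat (X t) + boundary_mat (n - 2) (f\<^sub>1 t) (f\<^sub>n t)))"
    if X: "\<forall>t\<ge>0. X t \<in> carrier_mat n p \<and> V t \<in> carrier_mat (n - 2) p"
  proof (intro all_cong1 imp_cong refl)
    fix t :: real assume t: "0 \<le> t"
    have U: "interior_mat (X s) \<in> carrier_mat (n - 2) p" and V: "V s \<in> carrier_mat (n - 2) p"
      if "s \<ge> 0" for s
      using X that by (auto intro: interior_mat_carrier)
    have B: "boundary_mat (n - 2) (f\<^sub>1 t) (f\<^sub>n t) \<in> carrier_mat (n - 2) p"
      using f[rule_format, OF t] by (intro boundary_mat_carrier) auto
    show "has_mat_derivative (\<lambda>s. interior_mat (X s) @\<^sub>r V s)
      (real_system_mat (n - 2) \<beta> * (interior_mat (X t) @\<^sub>r V t) + forcing_mat n p f\<^sub>1 f\<^sub>n t)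
      (at t within {0..}) \<longleftrightarrow>
      has_mat_derivative (\<lambda>s. interior_mat (X s)) (V t) (at t within {0..}) \<and>
     (\<exists>W \<in> carrier_mat (n - 2) p. has_mat_derivative V W (at t within {0..}) \<and>
        W + \<beta> \<cdot>\<^sub>m V t =
          tridiag_mat (n - 2) 1 (-2) 1 * interior_mat (X t) + boundary_mat (n - 2) (f\<^sub>1 t) (f\<^sub>n t))"
      unfolding forcing_mat_def by (rule flow_iff_first_order[OF U V B t])
  qed
  then show ?thesis
    unfolding hyperbolic_flow_solution_def by (auto simp only:)
qed

lemma forcing_mat_carrier:
  assumes "f\<^sub>1 t \<in> carrier_vec p" "f\<^sub>n t \<in> carrier_vec p"
  shows "forcing_mat n p f\<^sub>1 f\<^sub>n t \<in> carrier_mat (n - 2 + (n - 2)) p"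
  unfolding forcing_mat_def by (intro carrier_append_rows boundary_mat_carrier assms) simp

lemma continuous_on_forcing_mat:
  assumes f: "\<forall>t\<ge>0. f\<^sub>1 t \<in> carrier_vec p \<and> f\<^sub>n t \<in> carrier_vec p"
    and cont: "continuous_on {0..} (\<lambda>t. f\<^sub>1 t $ j)" "continuous_on {0..} (\<lambda>t. f\<^sub>n t $ j)"
    and ij: "i < n - 2 + (n - 2)" "j < p"
  shows "continuous_on {0..} (\<lambda>t. forcing_mat n p f\<^sub>1 f\<^sub>n t $$ (i, j))"
proof -
  let ?g = "\<lambda>t. if i < n - 2 then 0 else (if i - (n - 2) = 0 then f\<^sub>1 t $ j else 0) +
    (if i - (n - 2) = n - 2 - 1 then f\<^sub>n t $ j else 0)"
  have "continuous_on {0..} (\<lambda>t. if P then g t else 0)" if "continuous_on {0..} g"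
    for P and g :: "real \<Rightarrow> real"
    using that by (cases P) simp_all
  then have "continuous_on {0..} ?g"
    using cont by (cases "i < n - 2") (simp_all only: if_True if_False continuous_on_const continuous_on_add)
  moreover have "?g t = forcing_mat n p f\<^sub>1 f\<^sub>n t $$ (i, j)" if "t \<in> {0..}" for t
  proof -
    have ft: "f\<^sub>1 t \<in> carrier_vec p" "f\<^sub>n t \<in> carrier_vec p" using f that by auto
    have "boundary_mat (n - 2) (f\<^sub>1 t) (f\<^sub>n t) $$ (k, j) =
        (if k = 0 then f\<^sub>1 t $ j else 0) + (if k = n - 2 - 1 then f\<^sub>n t $ j else 0)" if "k < n - 2" for k
      using ft that ij(2) by (auto simp: boundary_mat_def row_mat_def)
    then show ?thesis
      unfolding forcing_mat_def index_append_rows[OF zero_carrier_mat boundary_mat_carrier[OF ft] ij]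
      using ij by auto
  qed
  ultimately show ?thesis by (rule continuous_on_eq)
qed

lemma curve_eqI:
  assumes n: "n \<ge> 2" and X: "X \<in> carrier_mat n p" "X' \<in> carrier_mat n p"
    and "row X 0 = row X' 0" "row X (n - 1) = row X' (n - 1)" "interior_mat X = interior_mat X'"
  shows "X = X'"
proof (rule eq_matI)
  fix i j assume "i < dim_row X'" "j < dim_col X'"
  then have ij: "i < n" "j < p" using X by auto
  consider "i = 0" | "i = n - 1" | k where "i = k + 1" "k < n - 2"
  proof -
    assume a: "i = 0 \<Longrightarrow> thesis" "i = n - 1 \<Longrightarrow> thesis" "\<And>k. i = k + 1 \<Longrightarrow> k < n - 2 \<Longrightarrow> thesis"
    show thesis
    proof (cases "i = 0 \<or> i = n - 1")
      case False
      then have "i = (i - 1) + 1" "i - 1 < n - 2" using ij(1) by auto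
      then show ?thesis by (rule a(3))
    qed (use a in blast)
  qed
  then show "X $$ (i, j) = X' $$ (i, j)"
  proof cases
    case 1
    then show ?thesis using arg_cong[OF assms(4), of "\<lambda>v. v $ j"] X ij by simp
  next
    case 2
    then show ?thesis using arg_cong[OF assms(5), of "\<lambda>v. v $ j"] X ij by simp
  next
    case (3 k)
    then show ?thesis
      using arg_cong[OF assms(6), of "\<lambda>A. A $$ (k, j)"] X ij by (simp add: interior_mat_def)
  qed
qed (use X in auto)

lemma append_rows_inject:
  assumes "A \<in> carrier_mat m p" "C \<in> carrier_mat m p" "B \<in> carrier_mat k p" "D \<in> carrier_mat k p"
    and eq: "A @\<^sub>r B = C @\<^sub>r D"
  shows "A = C \<and> B = D"
proof -
  have e: "(A @\<^sub>r B) $$ (i, j) = (C @\<^sub>r D) $$ (i, j)" for i j by (simp add: eq)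
  have "A = C"
  proof (rule eq_matI)
    fix i j assume "i < dim_row C" "j < dim_col C"
    then show "A $$ (i, j) = C $$ (i, j)"
      using e[of i j] assms(1-4) by (simp add: index_append_rows[where m = m and k = k and p = p])
  qed (use assms in auto)
  moreover have "B = D"
  proof (rule eq_matI)
    fix i j assume "i < dim_row D" "j < dim_col D"
    then show "B $$ (i, j) = D $$ (i, j)"
      using e[of "m + i" j] assms(1-4)
      by (simp add: index_append_rows[where m = m and k = k and p = p])
  qed (use assms in auto)
  ultimately show ?thesis ..
qed

lemma flow_solves_linear_system:
  assumes f: "\<forall>t\<ge>0. f\<^sub>1 t \<in> carrier_vec p \<and> f\<^sub>n t \<in> carrier_vec p"
    and sol: "hyperbolic_flow_solution n p \<beta> f\<^sub>1 f\<^sub>n X\<^sub>0 V\<^sub>0 X V"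
  shows "linear_system_solution (n - 2 + (n - 2)) p (system_mat n \<beta>)
    (\<lambda>t. cmat (forcing_mat n p f\<^sub>1 f\<^sub>n t)) (\<lambda>t. cmat (interior_mat (X t) @\<^sub>r V t))"
  unfolding cmat_real_system_mat[symmetric]
proof (rule linear_system_solution_cmat[OF _ real_system_mat_carrier])
  note sol = sol[unfolded hyperbolic_flow_solution_iff[OF f]]
  fix t :: real assume t: "t \<ge> 0"
  show "interior_mat (X t) @\<^sub>r V t \<in> carrier_mat (n - 2 + (n - 2)) p"
    using sol t by (intro carrier_append_rows interior_mat_carrier) auto
  show "forcing_mat n p f\<^sub>1 f\<^sub>n t \<in> carrier_mat (n - 2 + (n - 2)) p"
    using f[rule_format, OF t] by (intro forcing_mat_carrier) auto
  show "has_mat_derivative (\<lambda>s. interior_mat (X s) @\<^sub>r V s)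
      (real_system_mat (n - 2) \<beta> * (interior_mat (X t) @\<^sub>r V t) + forcing_mat n p f\<^sub>1 f\<^sub>n t)
      (at t within {0..})"
    using sol t by blast
qed

text \<open>
  The complexified first-order system fixes interior and velocity, and the boundary condition fixes
  the two remaining points of the curve.
\<close>

lemma flow_unique:
  assumes n: "n \<ge> 2"
    and f: "\<forall>t\<ge>0. f\<^sub>1 t \<in> carrier_vec p \<and> f\<^sub>n t \<in> carrier_vec p"
    and sol: "hyperbolic_flow_solution n p \<beta> f\<^sub>1 f\<^sub>n X\<^sub>0 V\<^sub>0 X V"
    and sol': "hyperbolic_flow_solution n p \<beta> f\<^sub>1 f\<^sub>n X\<^sub>0 V\<^sub>0 X' V'"
    and t: "t \<ge> 0"
  shows "X' t = X t \<and> V' t = V t"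
proof -
  note S = sol[unfolded hyperbolic_flow_solution_def]
  note S' = sol'[unfolded hyperbolic_flow_solution_def]
  have c: "X t \<in> carrier_mat n p" "V t \<in> carrier_mat (n - 2) p"
    "X' t \<in> carrier_mat n p" "V' t \<in> carrier_mat (n - 2) p"
    using S S' t by blast+
  have init: "X' 0 = X 0" "V' 0 = V 0" using S S' by auto
  have F: "cmat (forcing_mat n p f\<^sub>1 f\<^sub>n s) \<in> carrier_mat (n - 2 + (n - 2)) p" if "s \<ge> 0" for s
    using f[rule_format, OF that] by (simp add: forcing_mat_carrier)
  have "cmat (interior_mat (X' t) @\<^sub>r V' t) = cmat (interior_mat (X t) @\<^sub>r V t)"
    by (rule linear_system_unique[OF system_mat_carrier F flow_solves_linear_system[OF f sol']
          flow_solves_linear_system[OF f sol] _ t]) (simp_all only: init)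
  then have "interior_mat (X' t) @\<^sub>r V' t = interior_mat (X t) @\<^sub>r V t"
    by (rule of_real_hom.mat_hom_inj)
  then have UV: "interior_mat (X' t) = interior_mat (X t) \<and> V' t = V t"
    by (rule append_rows_inject[rotated 4]) (use c interior_mat_carrier in auto)
  have "row (X' t) 0 = row (X t) 0" "row (X' t) (n - 1) = row (X t) (n - 1)"
    using S S' t by auto
  then have "X' t = X t" using UV by (intro curve_eqI[OF n c(3,1)]) auto
  with UV show ?thesis by simp
qed

text \<open>
  The compatibility of the initial curve with the boundary values at time \<open>0\<close> makes the assembled
  curve start at \<open>X\<^sub>0\<close>.
\<close>

lemma flow_exists:
  assumes n: "n \<ge> 2"
    and X\<^sub>0: "X\<^sub>0 \<in> carrier_mat n p" and V\<^sub>0: "V\<^sub>0 \<in> carrier_mat (n - 2) p"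
    and f: "\<forall>t\<ge>0. f\<^sub>1 t \<in> carrier_vec p \<and> f\<^sub>n t \<in> carrier_vec p"
    and cont: "\<And>j. j < p \<Longrightarrow> continuous_on {0..} (\<lambda>t. f\<^sub>1 t $ j)"
      "\<And>j. j < p \<Longrightarrow> continuous_on {0..} (\<lambda>t. f\<^sub>n t $ j)"
    and compat: "row X\<^sub>0 0 = f\<^sub>1 0" "row X\<^sub>0 (n - 1) = f\<^sub>n 0"
  shows "\<exists>X V. hyperbolic_flow_solution n p \<beta> f\<^sub>1 f\<^sub>n X\<^sub>0 V\<^sub>0 X V"
proof -
  define m where "m = n - 2"
  define G where "G t = forcing_mat n p f\<^sub>1 f\<^sub>n t" for t
  define A where "A = real_system_mat m \<beta>"
  have A: "A \<in> carrier_mat (m + m) (m + m)"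
    unfolding A_def by (rule real_system_mat_carrier)
  have G: "G t \<in> carrier_mat (m + m) p" if "t \<ge> 0" for t
    unfolding G_def m_def using f[rule_format, OF that] by (simp add: forcing_mat_carrier)
  have Gcont: "continuous_on {0..} (\<lambda>t. cmat (G t) $$ (i, j))" if "i < m + m" "j < p" for i j
  proof -
    have "continuous_on {0..} (\<lambda>t. complex_of_real (G t $$ (i, j)))"
      unfolding G_def using that
      by (intro continuous_intros continuous_on_forcing_mat f cont) (simp_all add: m_def)
    then show ?thesis
    proof (rule continuous_on_eq)
      fix t :: real assume "t \<in> {0..}"
      then show "complex_of_real (G t $$ (i, j)) = cmat (G t) $$ (i, j)"
        using that carrier_matD[OF G, of t] by simp
    qed
  qed
  have C: "interior_mat X\<^sub>0 @\<^sub>r V\<^sub>0 \<in> carrier_mat (m + m) p"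
    unfolding m_def by (intro carrier_append_rows interior_mat_carrier X\<^sub>0 V\<^sub>0)
  have "\<exists>Y. Y 0 = cmat (interior_mat X\<^sub>0 @\<^sub>r V\<^sub>0) \<and>
      linear_system_solution (m + m) p (cmat A) (\<lambda>t. cmat (G t)) Y"
    by (rule linear_system_exists) (use A G Gcont C in auto)
  then obtain Y where Y0: "Y 0 = cmat (interior_mat X\<^sub>0 @\<^sub>r V\<^sub>0)"
    and Y: "linear_system_solution (m + m) p (cmat A) (\<lambda>t. cmat (G t)) Y" by blast
  define R where "R t = map_mat Re (Y t)" for t
  have Rc: "R t \<in> carrier_mat (m + m) p" if "t \<ge> 0" for t
    using linear_system_solution_carrier[OF Y that] by (simp add: R_def)
  have R0: "R 0 = interior_mat X\<^sub>0 @\<^sub>r V\<^sub>0"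
    unfolding R_def Y0 by (intro eq_matI) auto
  have R: "has_mat_derivative R (A * R t + G t) (at t within {0..})" if "t \<ge> 0" for t
    unfolding R_def by (rule real_part_solution[OF Y A G that])
  \<comment> \<open>the upper half of \<open>R\<close> becomes the interior of the curve, between the prescribed end points\<close>
  define V where "V t = mat m p (\<lambda>(i, j). R t $$ (m + i, j))" for t
  define X where "X t = mat n p (\<lambda>(i, j). if i = 0 then f\<^sub>1 t $ j else
    if i = n - 1 then f\<^sub>n t $ j else R t $$ (i - 1, j))" for t
  have Xc: "X t \<in> carrier_mat n p" and Vc: "V t \<in> carrier_mat (n - 2) p" for t
    by (simp_all add: X_def V_def m_def)
  have U: "interior_mat (X t) = mat m p (\<lambda>(i, j). R t $$ (i, j))" for t
    unfolding interior_mat_def X_def m_def by (intro eq_matI) auto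
  have XV: "interior_mat (X t) @\<^sub>r V t = R t" if "t \<ge> 0" for t
    unfolding U V_def append_rows_def using Rc[OF that] by (intro eq_matI) auto
  have rows: "row (X t) 0 = f\<^sub>1 t" "row (X t) (n - 1) = f\<^sub>n t" if "t \<ge> 0" for t
    using f[rule_format, OF that] n by (auto simp: X_def intro!: eq_vecI)
  have "interior_mat (X 0) = interior_mat X\<^sub>0 \<and> V 0 = V\<^sub>0"
    by (rule append_rows_inject[of _ "n - 2" p])
      (use XV[of 0] R0 Vc V\<^sub>0 interior_mat_carrier[OF Xc] interior_mat_carrier[OF X\<^sub>0] in auto)
  moreover from this have "X 0 = X\<^sub>0"
    using rows[of 0] compat by (intro curve_eqI[OF n Xc X\<^sub>0]) auto
  moreover have "has_mat_derivative (\<lambda>s. interior_mat (X s) @\<^sub>r V s)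
      (A * (interior_mat (X t) @\<^sub>r V t) + G t) (at t within {0..})" if t: "t \<ge> 0" for t
  proof -
    have "((\<lambda>s. (interior_mat (X s) @\<^sub>r V s) $$ ij) has_real_derivative d) (at t within {0..}) \<longleftrightarrow>
        ((\<lambda>s. R s $$ ij) has_real_derivative d) (at t within {0..})" for ij d
      using XV t by (intro has_field_derivative_cong_eventually) (auto simp: eventually_at_filter)
    then show ?thesis
      using R[OF t] by (simp add: has_mat_derivative_def XV[OF t])
  qed
  ultimately have "hyperbolic_flow_solution n p \<beta> f\<^sub>1 f\<^sub>n X\<^sub>0 V\<^sub>0 X V"
    unfolding hyperbolic_flow_solution_iff[OF f]
    using Xc Vc rows by (auto simp: A_def G_def m_def)
  then show ?thesis by blast
qed

section \<open>The spectral representation\<close>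

text \<open>
  \<open>Z = Q Y\<close> solves a diagonal system with inhomogeneity \<open>Q F\<close>; the formula for \<open>Z\<close> is multiplied by
  \<open>P\<close> to recover \<open>Y\<close>.
\<close>

lemma flow_spectral_formula:
  assumes n: "n \<ge> 3"
    and disc: "\<forall>k\<in>{1..n - 2}. \<beta>\<^sup>2 + 4 * mu n k \<noteq> 0"
    and f: "\<forall>t\<ge>0. f\<^sub>1 t \<in> carrier_vec p \<and> f\<^sub>n t \<in> carrier_vec p"
  shows "\<exists>Q \<in> carrier_mat (2 * n - 4) (2 * n - 4).
       inverts_mat (eigenvector_mat n \<beta>) Q \<and> inverts_mat Q (eigenvector_mat n \<beta>) \<and>
       (\<forall>X V. hyperbolic_flow_solution n p \<beta> f\<^sub>1 f\<^sub>n X\<^sub>0 V\<^sub>0 X V \<longrightarrow>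
          (\<forall>t\<ge>0.
             cmat (interior_mat (X t) @\<^sub>r V t) =
               eigenvector_mat n \<beta> * exp_diag n \<beta> t * Q * cmat (interior_mat X\<^sub>0 @\<^sub>r V\<^sub>0)
               + eigenvector_mat n \<beta> *
                   mat_integral 0 t
                     (\<lambda>s. exp_diag n \<beta> (t - s) * Q * cmat (forcing_mat n p f\<^sub>1 f\<^sub>n s))))"
proof -
  define N where "N = 2 * n - 4"
  have N: "n - 2 + (n - 2) = N" by (simp add: N_def)
  define P where "P = eigenvector_mat n \<beta>"
  have M: "system_mat n \<beta> \<in> carrier_mat N N"
    using system_mat_carrier[of n \<beta>] unfolding N .
  have P: "P \<in> carrier_mat N N"
    unfolding P_def eigenvector_mat_def N_def by (intro carrier_matI) simp_all
  have eig: "eigenvector (system_mat n \<beta>) (col P j) (lam n \<beta> j)" if "j < N" for j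
    unfolding P_def by (rule eigenvector_system_mat[OF n that[unfolded N_def]])
  have inj: "inj_on (lam n \<beta>) {..<N}"
    unfolding N_def by (rule inj_on_lam[OF disc])
  obtain Q where Q: "Q \<in> carrier_mat N N" "P * Q = 1\<^sub>m N" "Q * P = 1\<^sub>m N"
    and QM: "Q * system_mat n \<beta> = mat_diag N (lam n \<beta>) * Q"
    by (rule eigenvector_cols_inverse[OF M P eig inj])
  let ?F = "\<lambda>t. cmat (forcing_mat n p f\<^sub>1 f\<^sub>n t)"
  let ?E = "exp_diag n \<beta>"
  have E: "?E s = mat_diag N (\<lambda>j. exp (lam n \<beta> j * of_real s))" for s
    by (simp add: exp_diag_def N_def)
  have Ec: "?E s \<in> carrier_mat N N" for s unfolding E by simp
  have F: "?F s \<in> carrier_mat N p" if "s \<ge> 0" for s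
    using f[rule_format, OF that] forcing_mat_carrier[of f\<^sub>1 s p f\<^sub>n n] unfolding N by simp
  have QF: "Q * ?F s \<in> carrier_mat N p" if "s \<ge> 0" for s
    using Q(1) F[OF that] by simp
  have D: "mat_diag N (lam n \<beta>) \<in> carrier_mat N N" by simp
  have formula: "cmat (interior_mat (X t) @\<^sub>r V t) =
      P * ?E t * Q * cmat (interior_mat X\<^sub>0 @\<^sub>r V\<^sub>0) +
      P * mat_integral 0 t (\<lambda>s. ?E (t - s) * Q * ?F s)"
    if sol: "hyperbolic_flow_solution n p \<beta> f\<^sub>1 f\<^sub>n X\<^sub>0 V\<^sub>0 X V" and t: "t \<ge> 0" for X V t
  proof -
    let ?Y = "\<lambda>t. cmat (interior_mat (X t) @\<^sub>r V t)"
    have Y: "linear_system_solution N p (system_mat n \<beta>) ?F ?Y"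
      using flow_solves_linear_system[OF f sol] unfolding N .
    note Yc = linear_system_solution_carrier[OF Y]
    have Z: "linear_system_solution N p (mat_diag N (lam n \<beta>)) (\<lambda>t. Q * ?F t) (\<lambda>t. Q * ?Y t)"
      by (rule linear_system_solution_change_variables[OF Y M D Q(1) F QM])
    have I: "mat_integral 0 t (\<lambda>s. ?E (t - s) * (Q * ?F s)) = mat_integral 0 t (\<lambda>s. ?E (t - s) * Q * ?F s)"
    proof -
      have e: "?E (t - s) * (Q * ?F s) = ?E (t - s) * Q * ?F s" if "s \<ge> 0" for s
        by (rule assoc_mult_mat[OF Ec Q(1) F[OF that], symmetric])
      show ?thesis
        unfolding mat_integral_def e[OF order_refl]
        by (intro arg_cong[of _ _ "mat _ _"] ext) (auto intro!: integral_cong simp: e)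
    qed
    have "Q * ?Y t = ?E t * (Q * ?Y 0) + mat_integral 0 t (\<lambda>s. ?E (t - s) * (Q * ?F s))"
      unfolding E by (rule diagonal_system_formula[OF Z QF t])
    then have QY: "Q * ?Y t = ?E t * (Q * ?Y 0) + mat_integral 0 t (\<lambda>s. ?E (t - s) * Q * ?F s)"
      unfolding I .
    have Ic: "mat_integral 0 t (\<lambda>s. ?E (t - s) * Q * ?F s) \<in> carrier_mat N p"
    proof -
      have "?E (t - 0) * Q * ?F 0 \<in> carrier_mat N p"
        by (rule mult_carrier_mat[OF mult_carrier_mat[OF Ec Q(1)] F]) simp
      from carrier_matD[OF this] show ?thesis
        unfolding mat_integral_def by (simp only: mat_carrier)
    qed
    have Y0: "?Y 0 = cmat (interior_mat X\<^sub>0 @\<^sub>r V\<^sub>0)"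
      using sol by (simp add: hyperbolic_flow_solution_def)
    have "?Y t = P * Q * ?Y t" using Yc[OF t] Q(2) by simp
    also have "\<dots> = P * (Q * ?Y t)" by (rule assoc_mult_mat[OF P Q(1) Yc[OF t]])
    also have "\<dots> = P * (?E t * (Q * ?Y 0)) + P * mat_integral 0 t (\<lambda>s. ?E (t - s) * Q * ?F s)"
      unfolding QY
      by (rule mult_add_distrib_mat[OF P mult_carrier_mat[OF Ec mult_carrier_mat[OF Q(1) Yc]] Ic]) simp
    also have "P * (?E t * (Q * ?Y 0)) = P * ?E t * Q * ?Y 0"
      using assoc_mult_mat[OF P Ec mult_carrier_mat[OF Q(1) Yc[OF order_refl]], of t]
        assoc_mult_mat[OF mult_carrier_mat[OF P Ec] Q(1) Yc[OF order_refl], of t] by simp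
    finally show ?thesis unfolding Y0 .
  qed
  have "inverts_mat P Q \<and> inverts_mat Q P"
    unfolding inverts_mat_def carrier_matD[OF P] carrier_matD[OF Q(1)] using Q by simp
  with formula Q(1) show ?thesis
    unfolding N_def P_def by (intro bexI[of _ Q] conjI allI impI) auto
qed

theorem theorem2:
  fixes n p :: nat and \<beta> :: real
    and f\<^sub>1 f\<^sub>n :: "real \<Rightarrow> real vec"
    and X\<^sub>0 V\<^sub>0 :: "real mat"
  assumes "n \<ge> 4" and "p \<ge> 2" and "\<beta> \<ge> 0"
    and "X\<^sub>0 \<in> carrier_mat n p" and "V\<^sub>0 \<in> carrier_mat (n - 2) p"
    and "\<forall>t\<ge>0. f\<^sub>1 t \<in> carrier_vec p \<and> f\<^sub>n t \<in> carrier_vec p"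
    and "\<forall>j<p. continuous_on {0..} (\<lambda>t. f\<^sub>1 t $ j) \<and> continuous_on {0..} (\<lambda>t. f\<^sub>n t $ j)"
    and "row X\<^sub>0 0 = f\<^sub>1 0" and "row X\<^sub>0 (n - 1) = f\<^sub>n 0"
  shows
    "(\<exists>X V. hyperbolic_flow_solution n p \<beta> f\<^sub>1 f\<^sub>n X\<^sub>0 V\<^sub>0 X V \<and>
        (\<forall>X' V'. hyperbolic_flow_solution n p \<beta> f\<^sub>1 f\<^sub>n X\<^sub>0 V\<^sub>0 X' V' \<longrightarrow>
           (\<forall>t\<ge>0. X' t = X t \<and> V' t = V t))) \<and>
     ((\<forall>k\<in>{1..n - 2}. \<beta>\<^sup>2 + 4 * mu n k \<noteq> 0) \<longrightarrow>
        (\<exists>Q \<in> carrier_mat (2 * n - 4) (2 * n - 4).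
           inverts_mat (eigenvector_mat n \<beta>) Q \<and> inverts_mat Q (eigenvector_mat n \<beta>) \<and>
           (\<forall>X V. hyperbolic_flow_solution n p \<beta> f\<^sub>1 f\<^sub>n X\<^sub>0 V\<^sub>0 X V \<longrightarrow>
              (\<forall>t\<ge>0.
                 cmat (interior_mat (X t) @\<^sub>r V t) =
                   eigenvector_mat n \<beta> * exp_diag n \<beta> t * Q * cmat (interior_mat X\<^sub>0 @\<^sub>r V\<^sub>0)
                   + eigenvector_mat n \<beta> *
                       mat_integral 0 t
                         (\<lambda>s. exp_diag n \<beta> (t - s) * Q * cmat (forcing_mat n p f\<^sub>1 f\<^sub>n s))))))"
proof (intro conjI impI)
  have n: "n \<ge> 2" "n \<ge> 3" using assms(1) by linarith+
  note f = assms(6)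
  have "\<exists>X V. hyperbolic_flow_solution n p \<beta> f\<^sub>1 f\<^sub>n X\<^sub>0 V\<^sub>0 X V"
    by (rule flow_exists[OF n(1) assms(4,5) f]) (use assms(7-9) in auto)
  then obtain X V where sol: "hyperbolic_flow_solution n p \<beta> f\<^sub>1 f\<^sub>n X\<^sub>0 V\<^sub>0 X V" by blast
  show "\<exists>X V. hyperbolic_flow_solution n p \<beta> f\<^sub>1 f\<^sub>n X\<^sub>0 V\<^sub>0 X V \<and>
        (\<forall>X' V'. hyperbolic_flow_solution n p \<beta> f\<^sub>1 f\<^sub>n X\<^sub>0 V\<^sub>0 X' V' \<longrightarrow>
           (\<forall>t\<ge>0. X' t = X t \<and> V' t = V t))"
  proof (rule exI[of _ X], rule exI[of _ V], intro conjI[OF sol] allI impI)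
    fix X' V' and t :: real
    assume sol': "hyperbolic_flow_solution n p \<beta> f\<^sub>1 f\<^sub>n X\<^sub>0 V\<^sub>0 X' V'" and t: "t \<ge> 0"
    show "X' t = X t \<and> V' t = V t" by (rule flow_unique[OF n(1) f sol sol' t])
  qed
  assume disc: "\<forall>k\<in>{1..n - 2}. \<beta>\<^sup>2 + 4 * mu n k \<noteq> 0"
  from flow_spectral_formula[OF n(2) disc f]
  show "\<exists>Q \<in> carrier_mat (2 * n - 4) (2 * n - 4).
       inverts_mat (eigenvector_mat n \<beta>) Q \<and> inverts_mat Q (eigenvector_mat n \<beta>) \<and>
       (\<forall>X V. hyperbolic_flow_solution n p \<beta> f\<^sub>1 f\<^sub>n X\<^sub>0 V\<^sub>0 X V \<longrightarrow>
          (\<forall>t\<ge>0.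
             cmat (interior_mat (X t) @\<^sub>r V t) =
               eigenvector_mat n \<beta> * exp_diag n \<beta> t * Q * cmat (interior_mat X\<^sub>0 @\<^sub>r V\<^sub>0)
               + eigenvector_mat n \<beta> *
                   mat_integral 0 t
                     (\<lambda>s. exp_diag n \<beta> (t - s) * Q * cmat (forcing_mat n p f\<^sub>1 f\<^sub>n s))))"
    .
qed

end
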